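(* Let $\ell>3$ be a prime, $a\in\mathbb{Z}_{\ge1}$, and $b\in\mathbb{Z}$. Suppose that $H(an+b)\equiv 0\pmod{\ell}$ for all integers $n$. Then $H(an+bu^2)\equiv 0\pmod{\ell}$ for all integers $u$ with $\gcd(u,a)=1$ and all integers $n$.
   Context: $H(D)$ denotes the Hurwitz class number: $H(0)=-1/12$; for $D>0$ with $-D\equiv 0,1\pmod 4$, $H(D)$ is the number of $\mathrm{SL}_2(\mathbb{Z})$-equivalence classes of positive definite integral binary quadratic forms of discriminant $-D$, where classes containing a multiple of $x^2+y^2$ are counted with weight $1/2$ and classes containing a multiple of $x^2+xy+y^2$ with weight $1/3$; and $H(D)=0$ for all other integers $D$ (in particular for $D<0$). Congruences modulo $\ell$ between these rational numbers (whose denominators are prime to $\ell$) are understood in $\mathbb{Z}_{(\ell)}$. *)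

theory Defs
  imports Complex_Main "HOL-Computational_Algebra.Primes"
begin

text \<open>
  The triple \<open>(A, B, C)\<close> stands for the form \<open>A x\<^sup>2 + B x y + C y\<^sup>2\<close>; it need not be primitive.
\<close>

type_synonym bqf = "int \<times> int \<times> int"

fun bqf_eval :: "bqf \<Rightarrow> 'a::comm_ring_1 \<Rightarrow> 'a \<Rightarrow> 'a" where
  "bqf_eval (A, B, C) x y = of_int A * x\<^sup>2 + of_int B * x * y + of_int C * y\<^sup>2"

fun bqf_disc :: "bqf \<Rightarrow> int" where
  "bqf_disc (A, B, C) = B\<^sup>2 - 4 * A * C"

definition bqf_pos_def :: "bqf \<Rightarrow> bool" where
  "bqf_pos_def f \<longleftrightarrow> (\<forall>x y :: real. (x, y) \<noteq> (0, 0) \<longrightarrow> bqf_eval f x y > 0)"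

definition bqf_equiv :: "bqf \<Rightarrow> bqf \<Rightarrow> bool" where
  "bqf_equiv f g \<longleftrightarrow>
     (\<exists>p q r s :: int. p * s - q * r = 1 \<and>
        (\<forall>x y :: int. bqf_eval g x y = bqf_eval f (p * x + q * y) (r * x + s * y)))"

definition pos_def_forms :: "int \<Rightarrow> bqf set" where
  "pos_def_forms D = {f. bqf_pos_def f \<and> bqf_disc f = - D}"

definition bqf_classes :: "int \<Rightarrow> bqf set set" where
  "bqf_classes D =
     pos_def_forms D // {(f, g). f \<in> pos_def_forms D \<and> g \<in> pos_def_forms D \<and> bqf_equiv f g}"

definition class_weight :: "bqf set \<Rightarrow> rat" where
  "class_weight K =
     (if \<exists>m. (m, 0, m) \<in> K then 1 / 2
      else if \<exists>m. (m, m, m) \<in> K then 1 / 3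
      else 1)"

definition hurwitz_class_number :: "int \<Rightarrow> rat" where
  "hurwitz_class_number D =
     (if D = 0 then - 1 / 12
      else if D > 0 \<and> (- D) mod 4 \<in> {0, 1} then \<Sum>K\<in>bqf_classes D. class_weight K
      else 0)"

definition localized_ints :: "int \<Rightarrow> rat set" where
  "localized_ints l = {of_int p / of_int q | p q. \<not> l dvd q}"

definition cong_localized :: "int \<Rightarrow> rat \<Rightarrow> rat \<Rightarrow> bool" where
  "cong_localized l x y \<longleftrightarrow> (\<exists>z \<in> localized_ints l. x - y = of_int l * z)"

text \<open>
  The class relation is an equivalence relation with finitely many classes, so the sum in the
  class number is a genuine finite sum.
\<close>

lemma bqf_equiv_refl: "bqf_equiv f f"
  unfolding bqf_equiv_def by (rule exI[of _ 1], rule exI[of _ 0], rule exI[of _ 0], rule exI[of _ 1]) simp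

lemma bqf_equiv_sym:
  assumes "bqf_equiv f g"
  shows "bqf_equiv g f"
proof -
  obtain p q r s :: int where d: "p * s - q * r = 1"
    and e: "\<And>x y :: int. bqf_eval g x y = bqf_eval f (p * x + q * y) (r * x + s * y)"
    using assms unfolding bqf_equiv_def by blast
  have "bqf_eval f x y = bqf_eval g (s * x + (- q) * y) ((- r) * x + p * y)" for x y :: int
  proof -
    have "p * (s * x + (- q) * y) + q * ((- r) * x + p * y) = (p * s - q * r) * x"
      by (simp add: algebra_simps)
    moreover have "r * (s * x + (- q) * y) + s * ((- r) * x + p * y) = (p * s - q * r) * y"
      by (simp add: algebra_simps)
    ultimately show ?thesis by (simp only: e d mult_1)
  qed
  moreover have "s * p - (- q) * (- r) = 1" using d by (simp add: algebra_simps)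
  ultimately show ?thesis unfolding bqf_equiv_def by blast
qed

lemma bqf_equiv_trans:
  assumes "bqf_equiv f g" "bqf_equiv g h"
  shows "bqf_equiv f h"
proof -
  obtain p q r s :: int where d: "p * s - q * r = 1"
    and e: "\<And>x y :: int. bqf_eval g x y = bqf_eval f (p * x + q * y) (r * x + s * y)"
    using assms(1) unfolding bqf_equiv_def by blast
  obtain p' q' r' s' :: int where d': "p' * s' - q' * r' = 1"
    and e': "\<And>x y :: int. bqf_eval h x y = bqf_eval g (p' * x + q' * y) (r' * x + s' * y)"
    using assms(2) unfolding bqf_equiv_def by blast
  have "bqf_eval h x y = bqf_eval f ((p * p' + q * r') * x + (p * q' + q * s') * y)
      ((r * p' + s * r') * x + (r * q' + s * s') * y)" for x y :: int
    by (simp only: e e') (simp only: algebra_simps)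
  moreover have "(p * p' + q * r') * (r * q' + s * s') - (p * q' + q * s') * (r * p' + s * r')
      = (p * s - q * r) * (p' * s' - q' * r')"
    by (simp add: algebra_simps)
  then have "(p * p' + q * r') * (r * q' + s * s') - (p * q' + q * s') * (r * p' + s * r') = 1"
    by (simp add: d d')
  ultimately show ?thesis unfolding bqf_equiv_def by blast
qed

lemma equiv_bqf_classes:
  "equiv (pos_def_forms D)
     {(f, g). f \<in> pos_def_forms D \<and> g \<in> pos_def_forms D \<and> bqf_equiv f g}"
  by (rule equivI)
    (auto simp: refl_on_def sym_def trans_def
       intro: bqf_equiv_refl bqf_equiv_sym bqf_equiv_trans)

lemma bqf_pos_def_iff:
  assumes "B\<^sup>2 - 4 * A * C < 0"
  shows "bqf_pos_def (A, B, C) \<longleftrightarrow> A > 0"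
proof
  assume "bqf_pos_def (A, B, C)"
  then have "bqf_eval (A, B, C) (1::real) 0 > 0"
    unfolding bqf_pos_def_def by (metis prod.inject zero_neq_one)
  then show "A > 0" by simp
next
  assume A: "A > 0"
  show "bqf_pos_def (A, B, C)"
    unfolding bqf_pos_def_def
  proof (intro allI impI)
    fix x y :: real
    assume nz: "(x, y) \<noteq> (0, 0)"
    define a b c where "a = real_of_int A" and "b = real_of_int B" and "c = real_of_int C"
    have a: "a > 0" using A by (simp add: a_def)
    have "real_of_int (B\<^sup>2 - 4 * A * C) < 0" using assms by linarith
    then have d: "4 * a * c - b\<^sup>2 > 0" by (simp add: a_def b_def c_def)
    have id: "4 * a * (a * x\<^sup>2 + b * x * y + c * y\<^sup>2) = (2 * a * x + b * y)\<^sup>2 + (4 * a * c - b\<^sup>2) * y\<^sup>2"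
      by (simp add: power2_eq_square algebra_simps)
    have "(2 * a * x + b * y)\<^sup>2 + (4 * a * c - b\<^sup>2) * y\<^sup>2 > 0"
    proof (cases "y = 0")
      case True
      then show ?thesis using nz a by simp
    next
      case False
      then have "(4 * a * c - b\<^sup>2) * y\<^sup>2 > 0" using d by simp
      then show ?thesis by (simp add: add_nonneg_pos)
    qed
    then have "4 * a * (a * x\<^sup>2 + b * x * y + c * y\<^sup>2) > 0" by (simp only: id)
    then have "a * x\<^sup>2 + b * x * y + c * y\<^sup>2 > 0" using a by (simp add: zero_less_mult_iff)
    then show "bqf_eval (A, B, C) x y > 0" by (simp add: a_def b_def c_def)
  qed
qed

lemma bqf_equiv_swap: "bqf_equiv (A, B, C) (C, - B, A)"
  unfolding bqf_equiv_def
  by (rule exI[of _ 0], rule exI[of _ "- 1"], rule exI[of _ 1], rule exI[of _ 0])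
    (simp add: power2_eq_square algebra_simps)

lemma bqf_equiv_shift: "bqf_equiv (A, B, C) (A, B + 2 * A * k, A * k\<^sup>2 + B * k + C)"
  unfolding bqf_equiv_def
  by (rule exI[of _ 1], rule exI[of _ k], rule exI[of _ 0], rule exI[of _ 1])
    (simp add: power2_eq_square algebra_simps)

lemma bqf_reduction:
  assumes D: "D > 0" and f: "f \<in> pos_def_forms D"
  shows "\<exists>A B C. (A, B, C) \<in> pos_def_forms D \<and> bqf_equiv f (A, B, C) \<and> \<bar>B\<bar> \<le> A \<and> A \<le> C"
proof -
  define P where "P n \<longleftrightarrow> (\<exists>B C. (int n, B, C) \<in> pos_def_forms D \<and> bqf_equiv f (int n, B, C))" for n
  have mem: "(A, B, C) \<in> pos_def_forms D \<longleftrightarrow> A > 0 \<and> B\<^sup>2 - 4 * A * C = - D" for A B C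
    using D bqf_pos_def_iff[of B A C] by (auto simp: pos_def_forms_def)
  obtain A0 B0 C0 where f0: "f = (A0, B0, C0)" by (cases f)
  have "P (nat A0)"
    unfolding P_def using f mem[of A0 B0 C0] bqf_equiv_refl[of f] f0
    by (intro exI[of _ B0] exI[of _ C0]) simp
  then have least: "P (LEAST n. P n)" by (rule LeastI)
  define A where "A = int (LEAST n. P n)"
  obtain B C where BC: "(A, B, C) \<in> pos_def_forms D" "bqf_equiv f (A, B, C)"
    using least unfolding P_def A_def by blast
  have A: "A > 0" using BC mem by blast
  define k where "k = - ((B + A) div (2 * A))"
  define B' where "B' = B + 2 * A * k"
  define C' where "C' = A * k\<^sup>2 + B * k + C"
  have "B' = (B + A) mod (2 * A) - A"
    unfolding B'_def k_def by (simp add: minus_mult_div_eq_mod[symmetric] algebra_simps)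
  moreover have "0 \<le> (B + A) mod (2 * A)" "(B + A) mod (2 * A) < 2 * A" using A by simp_all
  ultimately have B': "\<bar>B'\<bar> \<le> A" by linarith
  have "B'\<^sup>2 - 4 * A * C' = B\<^sup>2 - 4 * A * C"
    by (simp add: B'_def C'_def power2_eq_square algebra_simps)
  then have m': "(A, B', C') \<in> pos_def_forms D" using BC mem by metis
  have e': "bqf_equiv f (A, B', C')"
    unfolding B'_def C'_def by (rule bqf_equiv_trans[OF BC(2) bqf_equiv_shift])
  have "4 * A * C' > 0"
    using m' mem D zero_le_power2[of B'] by (smt (verit))
  then have C': "C' > 0" using A by (simp add: zero_less_mult_iff)
  have "P (nat C')"
    unfolding P_def
  proof (intro exI conjI)
    show "(int (nat C'), - B', A) \<in> pos_def_forms D"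
      using m' C' mem by (simp add: mult.commute mult.left_commute)
    show "bqf_equiv f (int (nat C'), - B', A)"
      using bqf_equiv_trans[OF e' bqf_equiv_swap] C' by simp
  qed
  then have "(LEAST n. P n) \<le> nat C'" by (rule Least_le)
  then have "A \<le> C'" using C' unfolding A_def by linarith
  then show ?thesis using m' e' B' by blast
qed

lemma finite_bqf_classes:
  assumes D: "D > 0"
  shows "finite (bqf_classes D)"
proof -
  let ?R = "{(f, g). f \<in> pos_def_forms D \<and> g \<in> pos_def_forms D \<and> bqf_equiv f g}"
  let ?S = "{0..D} \<times> {- D..D} \<times> {0..D}"
  have "bqf_classes D \<subseteq> (\<lambda>g. ?R `` {g}) ` ?S"
  proof
    fix K
    assume "K \<in> bqf_classes D"
    then obtain f where f: "f \<in> pos_def_forms D" and K: "K = ?R `` {f}"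
      unfolding bqf_classes_def by (auto elim: quotientE)
    obtain A B C where g: "(A, B, C) \<in> pos_def_forms D" "bqf_equiv f (A, B, C)"
      and red: "\<bar>B\<bar> \<le> A" "A \<le> C"
      using bqf_reduction[OF D f] by blast
    have d: "B\<^sup>2 - 4 * A * C = - D" using g by (simp add: pos_def_forms_def)
    have A: "A > 0" using g d D bqf_pos_def_iff[of B A C] by (simp add: pos_def_forms_def)
    have "B\<^sup>2 \<le> A\<^sup>2" using red(1) A by (simp add: abs_le_square_iff[symmetric])
    also have "A\<^sup>2 \<le> A * C" using red A by (simp add: power2_eq_square)
    finally have "3 * (A * C) \<le> D" using d by linarith
    moreover have "C \<le> A * C" using A red by simp
    ultimately have "C \<le> D" using A red by linarith
    then have "(A, B, C) \<in> ?S" using red A by auto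
    moreover have "K = ?R `` {(A, B, C)}"
      unfolding K by (rule equiv_class_eq[OF equiv_bqf_classes]) (use f g in auto)
    ultimately show "K \<in> (\<lambda>g. ?R `` {g}) ` ?S" by blast
  qed
  then show ?thesis by (rule finite_subset) simp
qed

end

theory Submission
  imports Defs
begin

text \<open>
  Counting integer matrices of prime determinant \<open>p\<close> between representatives of form classes in two
  ways gives the Hecke relation
  \<open>H(p\<^sup>2 D) + (-D/p) H(D) + p H(D/p\<^sup>2) = (p + 1) H(D)\<close>.
  If \<open>m \<equiv> b u\<^sup>2\<close> and \<open>g u \<equiv> 1\<close> modulo \<open>a\<close>, then \<open>m g\<^sup>2 \<equiv> b\<close>, so \<open>\<ell>\<close> divides \<open>H(m g\<^sup>2)\<close>, and it suffices
  to find such a \<open>g\<close> coprime to \<open>2 \<ell> m\<close> for which \<open>H(m g\<^sup>2) / H(m)\<close> is a unit modulo \<open>\<ell>\<close>. A prime \<open>p\<close>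
  contributes a non-unit to this quotient only if it is inert, i.e. \<open>(-m/p) = -1\<close>, and \<open>p \<equiv> -2\<close> modulo \<open>\<ell>\<close>;
  in that case \<open>p\<^sup>3\<close> contributes the unit \<open>-2\<close>. The superfluous square is compensated by a factor
  \<open>x\<^sup>2 + m y\<^sup>2\<close> with \<open>a | y\<close>, which may be given any square unit as its residue modulo \<open>a\<close> and whose prime
  divisors all split, so that it contributes the unit \<open>x\<^sup>2 + m y\<^sup>2\<close> itself. This avoids Dirichlet's
  theorem on primes in progressions.
\<close>

section \<open>The action of integer matrices on forms\<close>

type_synonym mat2 = "int \<times> int \<times> int \<times> int"

fun mat_mul :: "mat2 \<Rightarrow> mat2 \<Rightarrow> mat2" where
  "mat_mul (a, b, c, d) (p, q, r, s) = (a * p + b * r, a * q + b * s, c * p + d * r, c * q + d * s)"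

fun mat_det :: "mat2 \<Rightarrow> int" where
  "mat_det (a, b, c, d) = a * d - b * c"

fun mat_adj :: "mat2 \<Rightarrow> mat2" where
  "mat_adj (a, b, c, d) = (d, - b, - c, a)"

text \<open>Substituting \<open>M\<close> into the form replaces its Gram matrix S by M^T S M. This
  is a right action, set up for all integer matrices because the Hecke correspondence needs
  determinant \<open>p\<close>.\<close>

fun bqf_act :: "bqf \<Rightarrow> mat2 \<Rightarrow> bqf" where
  "bqf_act (A, B, C) (p, q, r, s) =
     (A * p\<^sup>2 + B * p * r + C * r\<^sup>2, 2 * A * p * q + B * (p * s + q * r) + 2 * C * r * s,
      A * q\<^sup>2 + B * q * s + C * s\<^sup>2)"

fun bqf_scale :: "int \<Rightarrow> bqf \<Rightarrow> bqf" where
  "bqf_scale k (A, B, C) = (k * A, k * B, k * C)"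

definition SL2 :: "mat2 set" where
  "SL2 = {M. mat_det M = 1}"

definition bqf_auts :: "bqf \<Rightarrow> mat2 set" where
  "bqf_auts f = {M \<in> SL2. bqf_act f M = f}"

lemma mat_mul_assoc: "mat_mul (mat_mul L M) N = mat_mul L (mat_mul M N)"
  by (cases L; cases M; cases N) (simp add: algebra_simps)

lemma mat_mul_one [simp]: "mat_mul M (1, 0, 0, 1) = M" "mat_mul (1, 0, 0, 1) M = M"
  by (cases M; simp)+

lemma mat_det_mul: "mat_det (mat_mul M N) = mat_det M * mat_det N"
  by (cases M; cases N) (simp add: algebra_simps)

lemma mat_det_adj [simp]: "mat_det (mat_adj M) = mat_det M"
  by (cases M) (simp add: algebra_simps)

lemma mat_adj_adj [simp]: "mat_adj (mat_adj M) = M"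
  by (cases M) simp

lemma mat_mul_adj:
  "mat_mul M (mat_adj M) = (mat_det M, 0, 0, mat_det M)"
  "mat_mul (mat_adj M) M = (mat_det M, 0, 0, mat_det M)"
  by (cases M; simp add: algebra_simps)+

lemma SL2_one [simp]: "(1, 0, 0, 1) \<in> SL2"
  by (simp add: SL2_def)

lemma SL2_mul: "M \<in> SL2 \<Longrightarrow> N \<in> SL2 \<Longrightarrow> mat_mul M N \<in> SL2"
  by (simp add: SL2_def mat_det_mul)

lemma SL2_adj: "M \<in> SL2 \<Longrightarrow> mat_adj M \<in> SL2"
  by (simp add: SL2_def)

lemma SL2_mul_adj:
  "M \<in> SL2 \<Longrightarrow> mat_mul M (mat_adj M) = (1, 0, 0, 1)"
  "M \<in> SL2 \<Longrightarrow> mat_mul (mat_adj M) M = (1, 0, 0, 1)"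
  by (simp_all add: SL2_def mat_mul_adj)

lemma bqf_act_act: "bqf_act (bqf_act f M) N = bqf_act f (mat_mul M N)"
  by (cases f; cases M; cases N) (simp add: power2_eq_square algebra_simps)

lemma bqf_act_one [simp]: "bqf_act f (1, 0, 0, 1) = f"
  by (cases f) simp

lemma bqf_act_scalar: "bqf_act f (k, 0, 0, k) = bqf_scale (k\<^sup>2) f"
  by (cases f) (simp add: power2_eq_square algebra_simps)

lemma bqf_act_scale: "bqf_act (bqf_scale k f) M = bqf_scale k (bqf_act f M)"
  by (cases f; cases M) (simp add: algebra_simps)

lemma bqf_scale_inject: "k \<noteq> 0 \<Longrightarrow> bqf_scale k f = bqf_scale k g \<longleftrightarrow> f = g"
  by (cases f; cases g) simp

lemma bqf_scale_one [simp]: "bqf_scale 1 f = f"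
  by (cases f) simp

lemma bqf_disc_act: "bqf_disc (bqf_act f M) = (mat_det M)\<^sup>2 * bqf_disc f"
  by (cases f; cases M) (simp add: power2_eq_square algebra_simps)

lemma bqf_disc_scale: "bqf_disc (bqf_scale k f) = k\<^sup>2 * bqf_disc f"
  by (cases f) (simp add: power2_eq_square algebra_simps)

lemma SL2_act_cancel:
  assumes "M \<in> SL2"
  shows "bqf_act (bqf_act f M) (mat_adj M) = f" "bqf_act (bqf_act f (mat_adj M)) M = f"
  using assms by (simp_all add: bqf_act_act SL2_mul_adj)

lemma bqf_eval_act:
  fixes x y :: "'a::comm_ring_1"
  shows "bqf_eval (bqf_act f (p, q, r, s)) x y
    = bqf_eval f (of_int p * x + of_int q * y) (of_int r * x + of_int s * y)"
  by (cases f) (simp add: power2_eq_square algebra_simps)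

lemma bqf_eqI:
  assumes "\<And>x y :: int. bqf_eval f x y = bqf_eval g x y"
  shows "f = g"
proof -
  obtain A B C A' B' C' where fg: "f = (A, B, C)" "g = (A', B', C')"
    by (cases f, cases g) auto
  show ?thesis
    using assms[of 1 0] assms[of 0 1] assms[of 1 1] by (simp add: fg)
qed

lemma bqf_equiv_iff: "bqf_equiv f g \<longleftrightarrow> (\<exists>M \<in> SL2. g = bqf_act f M)"
proof
  assume "bqf_equiv f g"
  then obtain p q r s :: int where "p * s - q * r = 1"
    and e: "\<And>x y :: int. bqf_eval g x y = bqf_eval f (p * x + q * y) (r * x + s * y)"
    unfolding bqf_equiv_def by blast
  moreover have "g = bqf_act f (p, q, r, s)"
    by (rule bqf_eqI) (simp add: e bqf_eval_act)
  ultimately show "\<exists>M \<in> SL2. g = bqf_act f M"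
    by (intro bexI[of _ "(p, q, r, s)"]) (simp_all add: SL2_def)
next
  assume "\<exists>M \<in> SL2. g = bqf_act f M"
  then obtain p q r s where "p * s - q * r = 1" "g = bqf_act f (p, q, r, s)"
    by (auto simp: SL2_def)
  then show "bqf_equiv f g"
    unfolding bqf_equiv_def
    by (intro exI[of _ p] exI[of _ q] exI[of _ r] exI[of _ s]) (simp add: bqf_eval_act)
qed

lemma mem_pos_def_forms_iff:
  assumes "D > 0"
  shows "(A, B, C) \<in> pos_def_forms D \<longleftrightarrow> A > 0 \<and> B\<^sup>2 - 4 * A * C = - D"
  using assms bqf_pos_def_iff[of B A C] by (auto simp: pos_def_forms_def)

text \<open>The leading coefficient of the new form is the value of \<open>f\<close> at the first
  column of \<open>M\<close>, a nonzero vector because the determinant is nonzero. For negative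
  discriminant its sign decides definiteness.\<close>

lemma bqf_act_pos_def_forms:
  assumes D: "D > 0" and f: "f \<in> pos_def_forms D" and M: "mat_det M \<noteq> 0"
  shows "bqf_act f M \<in> pos_def_forms ((mat_det M)\<^sup>2 * D)"
proof -
  obtain p q r s where M_eq: "M = (p, q, r, s)" by (cases M)
  obtain A B C where g: "bqf_act f M = (A, B, C)" by (cases "bqf_act f M")
  have "bqf_eval f (real_of_int p) (real_of_int r) > 0"
  proof -
    have "(real_of_int p, real_of_int r) \<noteq> (0, 0)" using M by (auto simp: M_eq)
    then show ?thesis using f unfolding pos_def_forms_def bqf_pos_def_def by blast
  qed
  also have "bqf_eval f (real_of_int p) (real_of_int r) = bqf_eval (bqf_act f M) 1 0"
    by (simp add: M_eq bqf_eval_act)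
  finally have "A > 0" by (simp add: g)
  moreover have "bqf_disc (bqf_act f M) = - ((mat_det M)\<^sup>2 * D)"
    using f by (simp add: bqf_disc_act pos_def_forms_def)
  ultimately show ?thesis
    using D M by (simp add: g mem_pos_def_forms_iff)
qed

lemma bqf_act_SL2_pos_def_forms:
  assumes "D > 0" "f \<in> pos_def_forms D" "M \<in> SL2"
  shows "bqf_act f M \<in> pos_def_forms D"
  using bqf_act_pos_def_forms[OF assms(1,2), of M] assms(3) by (simp add: SL2_def)

lemma bqf_scale_pos_def_forms_iff:
  assumes "D > 0" "k > 0"
  shows "bqf_scale k f \<in> pos_def_forms (k\<^sup>2 * D) \<longleftrightarrow> f \<in> pos_def_forms D"
proof -
  obtain A B C where f: "f = (A, B, C)" by (cases f)
  have "bqf_disc (bqf_scale k f) = - (k\<^sup>2 * D) \<longleftrightarrow> k\<^sup>2 * bqf_disc f = k\<^sup>2 * (- D)"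
    by (simp add: bqf_disc_scale)
  also have "\<dots> \<longleftrightarrow> bqf_disc f = - D"
    using assms(2) by (subst mult_cancel_left) auto
  finally have "bqf_disc (bqf_scale k f) = - (k\<^sup>2 * D) \<longleftrightarrow> bqf_disc f = - D" .
  moreover have "0 < k * A \<longleftrightarrow> 0 < A" using assms(2) by (simp add: zero_less_mult_iff)
  ultimately show ?thesis
    using assms by (simp add: f mem_pos_def_forms_iff)
qed

section \<open>Automorphism groups as stabilizers\<close>

text \<open>The matrices carrying \<open>f\<close> to \<open>g\<close> form the coset M
  Aut(\<open>g\<close>), which is also Aut(\<open>f\<close>) M. Bijections transfer the
  cardinalities even before finiteness is established.\<close>

lemma card_transporter:
  assumes "M \<in> SL2" "bqf_act f M = g"
  shows "card {N \<in> SL2. bqf_act f N = g} = card (bqf_auts g)"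
    and "card {N \<in> SL2. bqf_act f N = g} = card (bqf_auts f)"
proof -
  have "bij_betw (mat_mul M) (bqf_auts g) {N \<in> SL2. bqf_act f N = g}"
    by (rule bij_betw_byWitness[where f' = "mat_mul (mat_adj M)"])
      (use assms in \<open>auto simp: bqf_auts_def SL2_mul SL2_adj bqf_act_act[symmetric] SL2_act_cancel
        mat_mul_assoc[symmetric] SL2_mul_adj\<close>)
  then show "card {N \<in> SL2. bqf_act f N = g} = card (bqf_auts g)"
    by (simp add: bij_betw_same_card)
  have "bij_betw (\<lambda>N. mat_mul N M) (bqf_auts f) {N \<in> SL2. bqf_act f N = g}"
    by (rule bij_betw_byWitness[where f' = "\<lambda>N. mat_mul N (mat_adj M)"])
      (use assms in \<open>auto simp: bqf_auts_def SL2_mul SL2_adj bqf_act_act[symmetric] SL2_act_cancel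
        mat_mul_assoc SL2_mul_adj\<close>)
  then show "card {N \<in> SL2. bqf_act f N = g} = card (bqf_auts f)"
    by (simp add: bij_betw_same_card)
qed

lemma card_bqf_auts_equiv:
  assumes "bqf_equiv f g"
  shows "card (bqf_auts f) = card (bqf_auts g)"
proof -
  obtain M where "M \<in> SL2" "bqf_act f M = g"
    using assms by (auto simp: bqf_equiv_iff)
  from card_transporter[OF this] show ?thesis by simp
qed

lemma bqf_auts_scale: "k \<noteq> 0 \<Longrightarrow> bqf_auts (bqf_scale k f) = bqf_auts f"
  by (simp add: bqf_auts_def bqf_act_scale bqf_scale_inject)

section \<open>Automorphs and the weights of classes\<close>

lemma sum_squares_eq_1_int:
  fixes x z :: int
  assumes "x\<^sup>2 + z\<^sup>2 = 1"
  shows "(x, z) \<in> {(1, 0), (- 1, 0), (0, 1), (0, - 1)}"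
proof -
  have "x\<^sup>2 \<le> 1\<^sup>2" "z\<^sup>2 \<le> 1\<^sup>2"
    using assms zero_le_power2[of x] zero_le_power2[of z] unfolding one_power2 by linarith+
  then have "\<bar>x\<bar> \<le> 1" "\<bar>z\<bar> \<le> 1"
    using abs_le_square_iff[of x 1] abs_le_square_iff[of z 1] by simp_all
  then have "x \<in> {-1, 0, 1}" "z \<in> {-1, 0, 1}" by auto
  then show ?thesis using assms by (elim insertE emptyE) simp_all
qed

lemma eisenstein_norm_eq_1_int:
  fixes x z :: int
  assumes "x\<^sup>2 + x * z + z\<^sup>2 = 1"
  shows "(x, z) \<in> {(1, 0), (- 1, 0), (0, 1), (0, - 1), (1, - 1), (- 1, 1)}"
proof -
  \<comment> \<open>Completing the square in either variable bounds both \<open>x\<close> and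
    \<open>z\<close> by 1 in absolute value.\<close>
  have "(2 * x + z)\<^sup>2 + 3 * z\<^sup>2 = 4" "(2 * z + x)\<^sup>2 + 3 * x\<^sup>2 = 4"
    using assms by (simp_all add: power2_eq_square algebra_simps)
  then have "3 * z\<^sup>2 \<le> 4" "3 * x\<^sup>2 \<le> 4"
    using zero_le_power2[of "2 * x + z"] zero_le_power2[of "2 * z + x"] by linarith+
  then have "x\<^sup>2 \<le> 1\<^sup>2" "z\<^sup>2 \<le> 1\<^sup>2"
    by simp_all
  then have "\<bar>x\<bar> \<le> 1" "\<bar>z\<bar> \<le> 1"
    using abs_le_square_iff[of x 1] abs_le_square_iff[of z 1] by simp_all
  then have "x \<in> {-1, 0, 1}" "z \<in> {-1, 0, 1}" by auto
  then show ?thesis using assms by (elim insertE emptyE) simp_all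
qed

text \<open>
  The entries of an automorph give a triple \<open>(z, w - x, - y)\<close> proportional to the form, because
  \<open>M\<^sup>T S M = S\<close> and \<open>det M = 1\<close> amount to \<open>M\<^sup>T S = S (adj M)\<close> for the Gram matrix \<open>S\<close>.
\<close>

lemma bqf_auts_proportional:
  assumes "(x, y, z, w) \<in> bqf_auts (A, B, C)"
  shows "A * (w - x) = B * z" "C * z = - A * y" "C * (w - x) = - B * y"
proof -
  have d: "x * w - y * z = 1" and e: "A = A * x\<^sup>2 + B * x * z + C * z\<^sup>2"
    "B = 2 * A * x * y + B * (x * w + y * z) + 2 * C * z * w"
    "C = A * y\<^sup>2 + B * y * w + C * w\<^sup>2"
    using assms by (auto simp: bqf_auts_def SL2_def)
  have "2 * (A * (w - x) - B * z) = 0" using d e by algebra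
  then show "A * (w - x) = B * z" by simp
  have "2 * (C * z + A * y) = 0" using d e by algebra
  then show "C * z = - A * y" by simp
  have "2 * (C * (w - x) + B * y) = 0" using d e by algebra
  then show "C * (w - x) = - B * y" by simp
qed

text \<open>Proportionality forces the shape \<open>(x, - z, z, x)\<close>, multiplication by the
  Gaussian integer x + iz, and the determinant condition makes it one of the four units.\<close>

lemma bqf_auts_square:
  assumes "m \<noteq> 0"
  shows "bqf_auts (m, 0, m) = {(1, 0, 0, 1), (- 1, 0, 0, - 1), (0, - 1, 1, 0), (0, 1, - 1, 0)}"
proof
  show "bqf_auts (m, 0, m) \<subseteq> {(1, 0, 0, 1), (- 1, 0, 0, - 1), (0, - 1, 1, 0), (0, 1, - 1, 0)}"
  proof
    fix M assume M: "M \<in> bqf_auts (m, 0, m)"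
    obtain x y z w where M_eq: "M = (x, y, z, w)" by (cases M)
    have "m * (w - x) = 0" "m * (y + z) = 0"
      using bqf_auts_proportional[OF M[unfolded M_eq]] by (simp_all add: algebra_simps)
    then have "w = x" "y = - z" using assms by auto
    moreover have "x * w - y * z = 1" using M by (simp add: M_eq bqf_auts_def SL2_def)
    ultimately have "x\<^sup>2 + z\<^sup>2 = 1" by (simp add: power2_eq_square)
    from sum_squares_eq_1_int[OF this]
    show "M \<in> {(1, 0, 0, 1), (- 1, 0, 0, - 1), (0, - 1, 1, 0), (0, 1, - 1, 0)}"
      unfolding M_eq \<open>w = x\<close> \<open>y = - z\<close> by auto
  qed
qed (simp add: bqf_auts_def SL2_def)

text \<open>The shape is now \<open>(x, - z, z, x + z)\<close>, whose determinant is the norm form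
  of the Eisenstein integers; this leaves their six units.\<close>

lemma bqf_auts_hexagonal:
  assumes "m \<noteq> 0"
  shows "bqf_auts (m, m, m) = {(1, 0, 0, 1), (- 1, 0, 0, - 1), (0, - 1, 1, 1), (0, 1, - 1, - 1),
    (1, 1, - 1, 0), (- 1, - 1, 1, 0)}" (is "_ = ?S")
proof
  show "bqf_auts (m, m, m) \<subseteq> ?S"
  proof
    fix M assume M: "M \<in> bqf_auts (m, m, m)"
    obtain x y z w where M_eq: "M = (x, y, z, w)" by (cases M)
    have "m * (w - x - z) = 0" "m * (y + z) = 0"
      using bqf_auts_proportional[OF M[unfolded M_eq]] by (simp_all add: algebra_simps)
    then have "w = x + z" "y = - z" using assms by auto
    moreover have "x * w - y * z = 1" using M by (simp add: M_eq bqf_auts_def SL2_def)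
    ultimately have "x\<^sup>2 + x * z + z\<^sup>2 = 1" by (simp add: power2_eq_square algebra_simps)
    from eisenstein_norm_eq_1_int[OF this] show "M \<in> ?S"
      unfolding M_eq \<open>w = x + z\<close> \<open>y = - z\<close> by (elim insertE emptyE) simp_all
  qed
qed (simp add: bqf_auts_def SL2_def)

text \<open>With trace \<open>t\<close>, proportionality and determinant 1 give A^2 (4 - t^2) = z^2
  D, while reducedness gives D >= 3 A^2. Hence a nonzero \<open>z\<close> leaves only z^2 = 1 and t
  in {0, 1, -1}, and these occur only for the two excluded shapes.\<close>

lemma reduced_bqf_auts:
  assumes f: "D > 0" "(A, B, C) \<in> pos_def_forms D" and red: "\<bar>B\<bar> \<le> A" "A \<le> C"
    and "\<not> (B = 0 \<and> A = C)" "\<not> (\<bar>B\<bar> = A \<and> A = C)"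
  shows "bqf_auts (A, B, C) = {(1, 0, 0, 1), (- 1, 0, 0, - 1)}"
proof
  have A: "A > 0" and D: "D = 4 * A * C - B\<^sup>2"
    using f by (simp_all add: mem_pos_def_forms_iff)
  have B2: "B\<^sup>2 \<le> A\<^sup>2" using red(1) A by (simp add: abs_le_square_iff[symmetric])
  have A2: "A\<^sup>2 \<le> A * C" using red(2) A by (simp add: power2_eq_square)
  show "bqf_auts (A, B, C) \<subseteq> {(1, 0, 0, 1), (- 1, 0, 0, - 1)}"
  proof
    fix M assume M: "M \<in> bqf_auts (A, B, C)"
    obtain x y z w where M_eq: "M = (x, y, z, w)" by (cases M)
    note prp = bqf_auts_proportional[OF M[unfolded M_eq]]
    have det: "x * w - y * z = 1" using M by (simp add: M_eq bqf_auts_def SL2_def)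
    define t where "t = x + w"
    have key: "A\<^sup>2 * (4 - t\<^sup>2) = z\<^sup>2 * D"
    proof -
      \<comment> \<open>Both sides are the discriminant of the characteristic polynomial of
        \<open>M\<close>.\<close>
      have e: "(w - x)\<^sup>2 + 4 * (y * z) = t\<^sup>2 - 4"
        using det unfolding t_def by algebra
      have "A\<^sup>2 * (4 - t\<^sup>2) = - (A * (w - x))\<^sup>2 + 4 * A * z * (- A * y)"
        using e by algebra
      also have "\<dots> = z\<^sup>2 * D"
        unfolding prp(1) prp(2)[symmetric] D by (simp add: power2_eq_square algebra_simps)
      finally show ?thesis .
    qed
    show "M \<in> {(1, 0, 0, 1), (- 1, 0, 0, - 1)}"
    proof (cases "z = 0")
      case True
      then have "w = x" "y = 0" using prp A by auto
      then have "x * x = 1" using det True by simp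
      then have "x = 1 \<or> x = - 1" using zmult_eq_1_iff[of x x] by auto
      then show ?thesis using True \<open>w = x\<close> \<open>y = 0\<close> by (auto simp: M_eq)
    next
      case False
      have z1: "1 \<le> z\<^sup>2" using False by (metis zero_less_power2 int_one_le_iff_zero_less)
      have D3: "3 * A\<^sup>2 \<le> D" using B2 A2 D by linarith
      have "A\<^sup>2 * (3 * z\<^sup>2) \<le> A\<^sup>2 * (4 - t\<^sup>2)"
        unfolding key using mult_left_mono[OF D3 zero_le_power2[of z]] by (simp add: mult_ac)
      then have le: "3 * z\<^sup>2 \<le> 4 - t\<^sup>2" using A by simp
      then have zz: "z\<^sup>2 = 1" using z1 zero_le_power2[of t] by linarith
      then have t1: "t\<^sup>2 \<le> 1" using le by simp
      then have "\<bar>t\<bar> \<le> 1" using abs_le_square_iff[of t 1] by simp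
      then consider "t = 0" | "t\<^sup>2 = 1" by (cases "t = 0"; cases "t = 1"; cases "t = -1") auto
      then have False
      proof cases
        case 1
        then have "w = - x" by (simp add: t_def)
        then have "A * (- 2 * x) = B * z" using prp(1) by simp
        then have "(2 * (A * x))\<^sup>2 = B\<^sup>2"
          using zz by algebra
        then have "4 * x\<^sup>2 * A\<^sup>2 \<le> 1 * A\<^sup>2" using B2 by (simp add: power_mult_distrib mult_ac)
        then have "4 * x\<^sup>2 \<le> 1" using A by (simp only: mult_le_cancel_right) simp
        then have "\<not> 0 < x\<^sup>2" by linarith
        then have "x = 0" by simp
        then have "B = 0" using \<open>(2 * (A * x))\<^sup>2 = B\<^sup>2\<close> by simp
        moreover have "A * A = A * C" using key 1 D \<open>B = 0\<close> unfolding zz by (simp add: power2_eq_square)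
        ultimately show False using assms(5) A by simp
      next
        case 2
        \<comment> \<open>The bound D >= 3 A^2 is attained, so both inequalities B^2 <= A^2 <= A C
          behind it are equalities.\<close>
        then have "3 * A\<^sup>2 = 4 * (A * C) - B\<^sup>2" using key zz D by (simp add: mult_ac)
        then have "A\<^sup>2 = A * C" "B\<^sup>2 = A\<^sup>2" using B2 A2 by linarith+
        then have "A = C" "\<bar>B\<bar> = A"
          using A by (simp_all add: power2_eq_square[of A] power2_eq_iff abs_if)
            (auto simp: power2_eq_iff simp flip: power2_eq_square)
        then show False using assms(6) by simp
      qed
      then show ?thesis ..
    qed
  qed
qed (simp add: bqf_auts_def SL2_def)


section \<open>Class representatives, and class numbers as weighted sums over automorphism
  groups\<close>

definition bqf_rep :: "bqf set \<Rightarrow> bqf" where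
  "bqf_rep K = (SOME f. f \<in> K)"

abbreviation bqf_rel :: "int \<Rightarrow> (bqf \<times> bqf) set" where
  "bqf_rel D \<equiv> {(f, g). f \<in> pos_def_forms D \<and> g \<in> pos_def_forms D \<and> bqf_equiv f g}"

lemma bqf_rep_mem:
  assumes "K \<in> bqf_classes D"
  shows "bqf_rep K \<in> K" "bqf_rep K \<in> pos_def_forms D"
proof -
  have K: "K \<in> pos_def_forms D // bqf_rel D" using assms by (simp add: bqf_classes_def)
  have "K \<noteq> {}" by (rule in_quotient_imp_non_empty[OF equiv_bqf_classes K])
  then show "bqf_rep K \<in> K" by (simp add: bqf_rep_def some_in_eq)
  then show "bqf_rep K \<in> pos_def_forms D"
    using in_quotient_imp_subset[OF equiv_bqf_classes K] by (rule rev_subsetD)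
qed

lemma bqf_class_eq:
  assumes "K \<in> bqf_classes D" "f \<in> K"
  shows "K = {g \<in> pos_def_forms D. bqf_equiv f g}"
proof -
  obtain g where "g \<in> pos_def_forms D" "K = bqf_rel D `` {g}"
    using assms(1) unfolding bqf_classes_def by (auto elim: quotientE)
  then show ?thesis
    using assms(2) by (auto intro: bqf_equiv_trans bqf_equiv_sym)
qed

lemma bqf_class_mem:
  assumes "f \<in> pos_def_forms D"
  shows "{g \<in> pos_def_forms D. bqf_equiv f g} \<in> bqf_classes D"
proof -
  have "bqf_rel D `` {f} \<in> bqf_classes D"
    unfolding bqf_classes_def by (rule quotientI[OF assms])
  also have "bqf_rel D `` {f} = {g \<in> pos_def_forms D. bqf_equiv f g}"
    using assms by auto
  finally show ?thesis .
qed

lemma mem_bqf_class_iff: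
  assumes "K \<in> bqf_classes D"
  shows "f \<in> K \<longleftrightarrow> f \<in> pos_def_forms D \<and> bqf_equiv f (bqf_rep K)"
  using bqf_class_eq[OF assms bqf_rep_mem(1)[OF assms]] bqf_equiv_sym by blast

lemma bqf_class_unique:
  assumes "K \<in> bqf_classes D" "K' \<in> bqf_classes D" "f \<in> K" "f \<in> K'"
  shows "K = K'"
  using bqf_class_eq[OF assms(1,3)] bqf_class_eq[OF assms(2,4)] by simp

text \<open>Every class contains a reduced form, whose automorphism group has order 4, 6 or 2, so
  the weights 1/2, 1/3 and 1 are uniformly 2/|Aut|. This frees the later counting from case
  distinctions.\<close>

lemma class_weight_eq:
  assumes D: "D > 0" and K: "K \<in> bqf_classes D"
  shows "class_weight K = 2 / of_nat (card (bqf_auts (bqf_rep K)))"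
    and "finite (bqf_auts (bqf_rep K))"
proof -
  have card_eq: "card (bqf_auts (bqf_rep K)) = card (bqf_auts f)" if "f \<in> K" for f
    using card_bqf_auts_equiv that mem_bqf_class_iff[OF K] by metis
  have nz: "A \<noteq> 0" if "(A, B, C) \<in> K" for A B C
    using that mem_bqf_class_iff[OF K] mem_pos_def_forms_iff[OF D] by fastforce
  have sq: "card (bqf_auts (bqf_rep K)) = 4" if "(m, 0, m) \<in> K" for m
    using card_eq[OF that] bqf_auts_square[OF nz[OF that]] by simp
  have hex: "card (bqf_auts (bqf_rep K)) = 6" if "(m, m, m) \<in> K" for m
    using card_eq[OF that] bqf_auts_hexagonal[OF nz[OF that]] by simp
  have other: "card (bqf_auts (bqf_rep K)) = 2"
    if no: "\<not> (\<exists>m. (m, 0, m) \<in> K)" "\<not> (\<exists>m. (m, m, m) \<in> K)"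
  proof -
    obtain A B C where g: "(A, B, C) \<in> pos_def_forms D" "bqf_equiv (bqf_rep K) (A, B, C)"
      and red: "\<bar>B\<bar> \<le> A" "A \<le> C"
      using bqf_reduction[OF D bqf_rep_mem(2)[OF K]] by blast
    have gK: "(A, B, C) \<in> K" using g bqf_equiv_sym mem_bqf_class_iff[OF K] by blast
    have "\<not> (\<bar>B\<bar> = A \<and> A = C)"
    proof
      assume h: "\<bar>B\<bar> = A \<and> A = C"
      \<comment> \<open>The reduced form (A, -A, A) is the boundary twin of (A, A, A): the shift by
        1 turns one into the other.\<close>
      then have "B = - A" using no(2) gK by (cases "B \<ge> 0") auto
      then have "bqf_equiv (A, B, C) (A, A, A)"
        using bqf_equiv_shift[of A B C 1] h by simp
      moreover have "(A, A, A) \<in> pos_def_forms D"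
        using g(1) h \<open>B = - A\<close> by (simp add: mem_pos_def_forms_iff[OF D])
      ultimately show False
        using no(2) bqf_class_eq[OF K gK] by blast
    qed
    moreover have "\<not> (B = 0 \<and> A = C)" using no(1) gK by auto
    ultimately show ?thesis
      using card_eq[OF gK] reduced_bqf_auts[OF D g(1) red] by simp
  qed
  show "class_weight K = 2 / of_nat (card (bqf_auts (bqf_rep K)))"
    using sq hex other unfolding class_weight_def by auto
  \<comment> \<open>\<open>card\<close> is 0 on infinite sets, so a nonzero cardinality proves
    finiteness.\<close>
  have "card (bqf_auts (bqf_rep K)) \<noteq> 0"
    using sq hex other by (metis zero_neq_numeral)
  then show "finite (bqf_auts (bqf_rep K))"
    by (rule contrapos_np) simp
qed

text \<open>Discriminants are squares modulo 4, so for the other residues the sum over classes is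
  empty and agrees with the value 0 prescribed by \<open>hurwitz_class_number\<close>.\<close>

lemma pos_def_forms_empty:
  assumes "(- D) mod 4 \<notin> {0, 1}"
  shows "pos_def_forms D = {}"
proof -
  have "(B\<^sup>2 - 4 * A * C) mod 4 \<in> {0, 1}" for A B C :: int
  proof -
    have "(B\<^sup>2 - 4 * A * C) mod 4 = (B mod 4)\<^sup>2 mod 4"
      by (simp add: power_mod mod_diff_eq[symmetric] mult.assoc)
    moreover have "B mod 4 \<in> {0, 1, 2, 3}" by auto
    ultimately show ?thesis by auto
  qed
  then show ?thesis using assms by (auto simp: pos_def_forms_def) metis+
qed

lemma hurwitz_class_number_eq:
  assumes "D > 0"
  shows "hurwitz_class_number D = 2 * (\<Sum>K\<in>bqf_classes D. 1 / of_nat (card (bqf_auts (bqf_rep K))))"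
proof -
  have "hurwitz_class_number D = (\<Sum>K\<in>bqf_classes D. class_weight K)"
    using assms pos_def_forms_empty[of D]
    by (auto simp: hurwitz_class_number_def bqf_classes_def quotient_def)
  then show ?thesis
    by (simp add: class_weight_eq(1)[OF assms] sum_distrib_left)
qed

section \<open>The Hecke correspondence\<close>

text \<open>Representatives of the integer matrices of determinant \<open>p\<close> modulo right
  multiplication by \<open>SL2\<close>. For prime \<open>p\<close> the lattices t Z^2 are the p + 1
  sublattices of index \<open>p\<close> in Z^2, one for each point of the projective line over
  F_p.\<close>

definition hermite_mats :: "int \<Rightarrow> mat2 set" where
  "hermite_mats p = insert (p, 0, 0, 1) ((\<lambda>j. (1, 0, j, p)) ` {0..<p})"

lemma mat_det_hermite: "t \<in> hermite_mats p \<Longrightarrow> mat_det t = p"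
  by (auto simp: hermite_mats_def)

lemma finite_hermite_mats [simp]: "finite (hermite_mats p)"
  by (simp add: hermite_mats_def)

lemma card_hermite_mats:
  assumes "p > 1"
  shows "card (hermite_mats p) = nat p + 1"
proof -
  have "card ((\<lambda>j. (1 :: int, 0 :: int, j, p)) ` {0..<p}) = nat p"
    by (subst card_image) (auto simp: inj_on_def)
  then show ?thesis
    using assms by (auto simp: hermite_mats_def card_insert_if)
qed

text \<open>Column reduction: a Bezout matrix clears the upper right entry and leaves gcd(a, b) in
  the upper left corner. It divides \<open>p\<close>, so it is 1 or \<open>p\<close>, and a further
  column operation normalizes the lower left entry.\<close>

lemma hermite_exists:
  fixes p :: int
  assumes p: "prime p" and M: "mat_det M = p"
  shows "\<exists>t \<in> hermite_mats p. \<exists>h \<in> SL2. M = mat_mul t h"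
proof -
  have p1: "p > 1" using p by (simp add: prime_gt_1_int)
  obtain a b c d where M_eq: "M = (a, b, c, d)" by (cases M)
  have det: "a * d - b * c = p" using M by (simp add: M_eq)
  define g where "g = gcd a b"
  have gp: "g dvd p" unfolding g_def det[symmetric] by auto
  have g0: "g > 0"
  proof -
    have "a \<noteq> 0 \<or> b \<noteq> 0" using det p1 by auto
    then show ?thesis by (simp add: g_def)
  qed
  obtain a' b' where ab: "a = g * a'" "b = g * b'"
    unfolding g_def by (meson dvdE gcd_dvd1 gcd_dvd2)
  obtain u v where uv: "u * a + v * b = g" unfolding g_def using bezout_int by blast
  have "g * (u * a' + v * b') = g * 1" using uv ab by (simp add: algebra_simps)
  then have uv': "a' * u + b' * v = 1" using g0 by (simp add: mult.commute)
  \<comment> \<open>The first row of \<open>h\<close> is (a, b)/g, so multiplying by its inverse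
    takes the row (a, b) to (g, 0).\<close>
  define h where "h = (a', b', - v, u)"
  have h: "h \<in> SL2" using uv' by (simp add: h_def SL2_def)
  define N where "N = mat_mul M (mat_adj h)"
  define c' e where "c' = c * u + d * v" and "e = d * a' - c * b'"
  have "a * u + b * v = g" using uv by (simp add: mult.commute)
  then have N_eq: "N = (g, 0, c', e)"
    by (simp add: N_def M_eq h_def c'_def e_def) (simp add: ab)
  have MN: "M = mat_mul N h"
    using h by (simp add: N_def mat_mul_assoc SL2_mul_adj)
  have "mat_det N = p" using M h by (simp add: N_def mat_det_mul SL2_def)
  then have ge: "g * e = p" by (simp add: N_eq)
  have "g = 1 \<or> g = p"
    using gp p g0 by (metis prime_int_iff le_less)
  then show ?thesis
  proof
    assume g1: "g = 1"
    define k where "k = c' div p"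
    have "N = mat_mul (1, 0, c' mod p, p) (1, 0, k, 1)"
      using ge g1 by (simp add: N_eq k_def)
    then have "M = mat_mul (1, 0, c' mod p, p) (mat_mul (1, 0, k, 1) h)"
      using MN by (simp only: mat_mul_assoc)
    moreover have "(1, 0, c' mod p, p) \<in> hermite_mats p"
      using p1 by (auto simp: hermite_mats_def)
    moreover have "mat_mul (1, 0, k, 1) h \<in> SL2"
      using h by (intro SL2_mul) (simp_all add: SL2_def)
    ultimately show ?thesis by blast
  next
    assume gp: "g = p"
    then have "e = 1" using ge p1 by simp
    then have "N = mat_mul (p, 0, 0, 1) (1, 0, c', 1)"
      using gp by (simp add: N_eq)
    then have "M = mat_mul (p, 0, 0, 1) (mat_mul (1, 0, c', 1) h)"
      using MN by (simp only: mat_mul_assoc)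
    moreover have "mat_mul (1, 0, c', 1) h \<in> SL2"
      using h by (intro SL2_mul) (simp_all add: SL2_def)
    ultimately show ?thesis
      unfolding hermite_mats_def by blast
  qed
qed

text \<open>The quotient of \<open>h\<close> by \<open>h'\<close> carries \<open>t\<close> to
  \<open>t'\<close>. Two matrices of different shape would make \<open>p\<close> a unit; for equal
  shapes only the identity remains, since the entries \<open>j\<close> lie in one period.\<close>

lemma hermite_unique:
  assumes p: "p > 1" and t: "t \<in> hermite_mats p" "t' \<in> hermite_mats p"
    and h: "h \<in> SL2" "h' \<in> SL2" and eq: "mat_mul t h = mat_mul t' h'"
  shows "t = t' \<and> h = h'"
proof -
  define k where "k = mat_mul h (mat_adj h')"
  have tk: "mat_mul t k = t'"
    using arg_cong[OF eq, of "\<lambda>M. mat_mul M (mat_adj h')"] h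
    by (simp add: k_def mat_mul_assoc SL2_mul_adj)
  have kh: "h = mat_mul k h'"
    using h by (simp add: k_def mat_mul_assoc SL2_mul_adj)
  obtain x y z w where k_eq: "k = (x, y, z, w)" by (cases k)
  have no: "p * i \<noteq> 1" for i using p by (auto simp: zmult_eq_1_iff)
  have "k = (1, 0, 0, 1)"
  proof (cases "t = (p, 0, 0, 1)")
    case True
    then show ?thesis
      using tk t(2) p no by (auto simp: k_eq hermite_mats_def)
  next
    case False
    then obtain j where j: "t = (1, 0, j, p)" "0 \<le> j" "j < p"
      using t(1) by (auto simp: hermite_mats_def)
    show ?thesis
    proof (cases "t' = (p, 0, 0, 1)")
      case True
      then show ?thesis using tk p no by (auto simp: k_eq j(1))
    next
      case False
      then obtain i where i: "t' = (1, 0, i, p)" "0 \<le> i" "i < p"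
        using t(2) by (auto simp: hermite_mats_def)
      have xy: "x = 1" "y = 0" "w = 1" "j + p * z = i"
        using tk p by (auto simp: k_eq j(1) i(1))
      have "i = (j + p * z) mod p" using i xy by simp
      also have "\<dots> = j" using j by simp
      finally show ?thesis using xy p by (simp add: k_eq)
    qed
  qed
  then show ?thesis using tk kh by simp
qed

lemma det_bij_hermite_SL2:
  assumes "prime p"
  shows "bij_betw (\<lambda>x. mat_mul (fst x) (snd x)) (hermite_mats p \<times> SL2) {M. mat_det M = p}"
proof (rule bij_betw_imageI)
  show "inj_on (\<lambda>x. mat_mul (fst x) (snd x)) (hermite_mats p \<times> SL2)"
  proof (rule inj_onI)
    fix x y assume "x \<in> hermite_mats p \<times> SL2" "y \<in> hermite_mats p \<times> SL2"
      "mat_mul (fst x) (snd x) = mat_mul (fst y) (snd y)"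
    then have "fst x = fst y \<and> snd x = snd y"
      by (intro hermite_unique[OF prime_gt_1_int[OF assms]])
        (simp_all only: mem_Times_iff)
    then show "x = y" by (simp add: prod_eq_iff)
  qed
  show "(\<lambda>x. mat_mul (fst x) (snd x)) ` (hermite_mats p \<times> SL2) = {M. mat_det M = p}"
  proof (intro equalityI subsetI)
    fix M assume "M \<in> (\<lambda>x. mat_mul (fst x) (snd x)) ` (hermite_mats p \<times> SL2)"
    then obtain x where "x \<in> hermite_mats p \<times> SL2" "M = mat_mul (fst x) (snd x)" by (rule imageE)
    then show "M \<in> {M. mat_det M = p}"
      by (simp add: mem_Times_iff mat_det_mul mat_det_hermite SL2_def)
  next
    fix M assume "M \<in> {M. mat_det M = p}"
    then obtain t h where "t \<in> hermite_mats p" "h \<in> SL2" "M = mat_mul t h"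
      using hermite_exists[OF assms] by blast
    then show "M \<in> (\<lambda>x. mat_mul (fst x) (snd x)) ` (hermite_mats p \<times> SL2)"
      by (intro image_eqI[where x = "(t, h)"]) simp_all
  qed
qed

section \<open>Counting matrices of prime determinant between form classes\<close>

lemma card_bqf_auts_pos:
  assumes "D > 0" "K \<in> bqf_classes D"
  shows "card (bqf_auts (bqf_rep K)) > 0"
proof -
  have "(1, 0, 0, 1) \<in> bqf_auts (bqf_rep K)" by (simp add: bqf_auts_def)
  then show ?thesis using class_weight_eq(2)[OF assms] card_gt_0_iff by blast
qed

text \<open>Factor M = t h uniquely. If \<open>t\<close> carries \<open>g\<close> to
  \<open>k\<close> times a form in \<open>K\<close>, the admissible \<open>h\<close> form a
  transporter within the class and number |Aut|; otherwise there are none. The scalar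
  \<open>k\<close> will be 1 in one direction and p^2 in the other.\<close>

lemma card_det_transporter:
  assumes p: "prime p" and D: "D > 0" and k: "k \<noteq> 0" and K: "K \<in> bqf_classes D"
  shows "card {M. mat_det M = p \<and> bqf_act g M = bqf_scale k (bqf_rep K)}
    = card {t \<in> hermite_mats p. \<exists>f \<in> K. bqf_act g t = bqf_scale k f} * card (bqf_auts (bqf_rep K))"
proof -
  let ?f = "bqf_rep K"
  let ?T = "{t \<in> hermite_mats p. \<exists>f \<in> K. bqf_act g t = bqf_scale k f}"
  define S where "S t = {h \<in> SL2. bqf_act (bqf_act g t) h = bqf_scale k ?f}" for t
  have card_S: "card (S t) = card (bqf_auts ?f)" if t: "t \<in> ?T" for t
  proof -
    obtain f where f: "f \<in> K" "bqf_act g t = bqf_scale k f" using t by blast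
    then obtain M where M: "M \<in> SL2" "?f = bqf_act f M"
      using mem_bqf_class_iff[OF K] bqf_equiv_iff by blast
    have "S t = {h \<in> SL2. bqf_act f h = ?f}"
      using k by (simp add: S_def f(2) bqf_act_scale bqf_scale_inject)
    then show ?thesis using card_transporter(1)[OF M(1) M(2)[symmetric]] by simp
  qed
  have S_empty: "t \<in> ?T" if t: "t \<in> hermite_mats p" and h: "h \<in> S t" for t h
  proof -
    have h': "h \<in> SL2" "bqf_act (bqf_act g t) h = bqf_scale k ?f" using h by (auto simp: S_def)
    define f where "f = bqf_act ?f (mat_adj h)"
    have "bqf_act g t = bqf_scale k f"
      using h' SL2_act_cancel(1)[OF h'(1), of "bqf_act g t"] by (simp add: f_def bqf_act_scale)
    moreover have "f \<in> K"
    proof -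
      have "bqf_act f h = ?f" using h' by (simp add: f_def SL2_act_cancel)
      then have "bqf_equiv f ?f" unfolding bqf_equiv_iff using h'(1) by (intro bexI[of _ h]) simp_all
      moreover have "f \<in> pos_def_forms D"
        unfolding f_def using D bqf_rep_mem[OF K] h' by (intro bqf_act_SL2_pos_def_forms SL2_adj)
      ultimately show ?thesis by (simp add: mem_bqf_class_iff[OF K])
    qed
    ultimately show ?thesis using t by blast
  qed
  have "bij_betw (\<lambda>x. mat_mul (fst x) (snd x)) (Sigma ?T S)
      {M. mat_det M = p \<and> bqf_act g M = bqf_scale k ?f}"
  proof (rule bij_betw_subset[OF det_bij_hermite_SL2[OF p]])
    show "Sigma ?T S \<subseteq> hermite_mats p \<times> SL2" by (auto simp: S_def)
    show "(\<lambda>x. mat_mul (fst x) (snd x)) ` Sigma ?T S = {M. mat_det M = p \<and> bqf_act g M = bqf_scale k ?f}"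
    proof (intro equalityI subsetI)
      fix M assume "M \<in> (\<lambda>x. mat_mul (fst x) (snd x)) ` Sigma ?T S"
      then obtain x where x: "x \<in> Sigma ?T S" "M = mat_mul (fst x) (snd x)" by (rule imageE)
      then have "fst x \<in> hermite_mats p" "snd x \<in> S (fst x)"
        by (simp_all add: mem_Sigma_iff[of "fst x" "snd x", simplified])
      then show "M \<in> {M. mat_det M = p \<and> bqf_act g M = bqf_scale k ?f}"
        by (simp add: x S_def mat_det_mul mat_det_hermite SL2_def bqf_act_act)
    next
      fix M assume M: "M \<in> {M. mat_det M = p \<and> bqf_act g M = bqf_scale k ?f}"
      then obtain t h where th: "t \<in> hermite_mats p" "h \<in> SL2" "M = mat_mul t h"
        using hermite_exists[OF p] by blast
      have hS: "h \<in> S t" using M th by (simp add: S_def bqf_act_act)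
      have "(t, h) \<in> Sigma ?T S" using S_empty[OF th(1) hS] hS by blast
      then show "M \<in> (\<lambda>x. mat_mul (fst x) (snd x)) ` Sigma ?T S"
        using th(3) by (intro image_eqI[where x = "(t, h)"]) simp_all
    qed
  qed
  then have "card {M. mat_det M = p \<and> bqf_act g M = bqf_scale k ?f} = card (Sigma ?T S)"
    by (simp add: bij_betw_same_card)
  also have "\<dots> = (\<Sum>t\<in>?T. card (S t))"
  proof (rule card_SigmaI)
    show "\<forall>t\<in>?T. finite (S t)"
    proof
      fix t assume "t \<in> ?T"
      then have "card (S t) > 0" using card_S card_bqf_auts_pos[OF D K] by simp
      then show "finite (S t)" by (rule card_ge_0_finite)
    qed
  qed simp
  also have "\<dots> = card ?T * card (bqf_auts ?f)" using card_S by simp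
  finally show ?thesis .
qed

text \<open>Dividing by |Aut| leaves, for each class, the number of Hermite matrices leading into
  it. These sets are disjoint, because scaling is injective and classes are disjoint, and they
  exhaust the set on the right.\<close>

lemma sum_card_det_transporter:
  assumes p: "prime p" and D: "D > 0" and k: "k \<noteq> 0"
  shows "(\<Sum>K\<in>bqf_classes D. of_nat (card {M. mat_det M = p \<and> bqf_act g M = bqf_scale k (bqf_rep K)})
      / of_nat (card (bqf_auts (bqf_rep K))))
    = (of_nat (card {t \<in> hermite_mats p. \<exists>f \<in> pos_def_forms D. bqf_act g t = bqf_scale k f}) :: rat)"
proof -
  let ?T = "\<lambda>K. {t \<in> hermite_mats p. \<exists>f \<in> K. bqf_act g t = bqf_scale k f}"
  have "(\<Sum>K\<in>bqf_classes D. of_nat (card {M. mat_det M = p \<and> bqf_act g M = bqf_scale k (bqf_rep K)})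
      / of_nat (card (bqf_auts (bqf_rep K)))) = (\<Sum>K\<in>bqf_classes D. (of_nat (card (?T K)) :: rat))"
    using card_bqf_auts_pos[OF D] by (intro sum.cong) (simp_all add: card_det_transporter[OF p D k])
  also have "\<dots> = of_nat (\<Sum>K\<in>bqf_classes D. card (?T K))" by simp
  also have "(\<Sum>K\<in>bqf_classes D. card (?T K)) = card (\<Union>K\<in>bqf_classes D. ?T K)"
  proof (rule card_UN_disjoint[symmetric])
    show "\<forall>K\<in>bqf_classes D. \<forall>K'\<in>bqf_classes D. K \<noteq> K' \<longrightarrow> ?T K \<inter> ?T K' = {}"
    proof (intro ballI impI equals0I)
      fix K K' t assume K: "K \<in> bqf_classes D" "K' \<in> bqf_classes D" "K \<noteq> K'" and "t \<in> ?T K \<inter> ?T K'"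
      then obtain f f' where f: "f \<in> K" "f' \<in> K'"
        "bqf_act g t = bqf_scale k f" "bqf_act g t = bqf_scale k f'" by blast
      then have "f = f'" using bqf_scale_inject[OF k] by simp
      then show False using bqf_class_unique[OF K(1,2)] K(3) f(1,2) by blast
    qed
  qed (simp_all add: finite_bqf_classes[OF D])
  also have "(\<Union>K\<in>bqf_classes D. ?T K) =
      {t \<in> hermite_mats p. \<exists>f \<in> pos_def_forms D. bqf_act g t = bqf_scale k f}"
  proof (intro equalityI subsetI)
    fix t assume "t \<in> (\<Union>K\<in>bqf_classes D. ?T K)"
    then show "t \<in> {t \<in> hermite_mats p. \<exists>f \<in> pos_def_forms D. bqf_act g t = bqf_scale k f}"
      using mem_bqf_class_iff by blast
  next
    fix t assume "t \<in> {t \<in> hermite_mats p. \<exists>f \<in> pos_def_forms D. bqf_act g t = bqf_scale k f}"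
    then obtain f where f: "t \<in> hermite_mats p" "f \<in> pos_def_forms D" "bqf_act g t = bqf_scale k f" by blast
    moreover have "f \<in> {h \<in> pos_def_forms D. bqf_equiv f h}" using f bqf_equiv_refl by blast
    ultimately show "t \<in> (\<Union>K\<in>bqf_classes D. ?T K)" using bqf_class_mem by blast
  qed
  finally show ?thesis .
qed

text \<open>Passing to the adjugate reverses arrows: \<open>M\<close> times \<open>mat_adj M\<close>
  is the scalar matrix \<open>p\<close>, which multiplies every form by p^2.\<close>

lemma card_det_transporter_adj:
  assumes p: "p \<noteq> 0"
  shows "card {M. mat_det M = p \<and> bqf_act f M = g}
    = card {M. mat_det M = p \<and> bqf_act g M = bqf_scale (p\<^sup>2) f}"
proof -
  have scale: "bqf_act (bqf_act h M) (mat_adj M) = bqf_scale (p\<^sup>2) h"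
    "bqf_act (bqf_act h (mat_adj M)) M = bqf_scale (p\<^sup>2) h" if "mat_det M = p" for h M
    using that by (simp_all add: bqf_act_act mat_mul_adj bqf_act_scalar)
  have "bij_betw mat_adj {M. mat_det M = p \<and> bqf_act f M = g}
      {M. mat_det M = p \<and> bqf_act g M = bqf_scale (p\<^sup>2) f}"
  proof (rule bij_betw_byWitness[where f' = mat_adj])
    show "mat_adj ` {M. mat_det M = p \<and> bqf_act f M = g}
        \<subseteq> {M. mat_det M = p \<and> bqf_act g M = bqf_scale (p\<^sup>2) f}"
    proof (rule image_subsetI)
      fix M assume "M \<in> {M. mat_det M = p \<and> bqf_act f M = g}"
      then have "mat_det M = p" "bqf_act f M = g" by simp_all
      then show "mat_adj M \<in> {M. mat_det M = p \<and> bqf_act g M = bqf_scale (p\<^sup>2) f}"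
        using scale(1)[of M f] by simp
    qed
    show "mat_adj ` {M. mat_det M = p \<and> bqf_act g M = bqf_scale (p\<^sup>2) f}
        \<subseteq> {M. mat_det M = p \<and> bqf_act f M = g}"
    proof (rule image_subsetI)
      fix M assume "M \<in> {M. mat_det M = p \<and> bqf_act g M = bqf_scale (p\<^sup>2) f}"
      then have M: "mat_det M = p" "bqf_act g M = bqf_scale (p\<^sup>2) f" by simp_all
      have "bqf_scale (p\<^sup>2) (bqf_act f (mat_adj M)) = bqf_act (bqf_act g M) (mat_adj M)"
        using M by (simp add: bqf_act_scale)
      also have "\<dots> = bqf_scale (p\<^sup>2) g" by (rule scale(1)[OF M(1)])
      finally have "bqf_act f (mat_adj M) = g" using p by (simp add: bqf_scale_inject)
      then show "mat_adj M \<in> {M. mat_det M = p \<and> bqf_act f M = g}" using M by simp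
    qed
  qed simp_all
  then show ?thesis by (rule bij_betw_same_card)
qed

text \<open>
  Restricting a form along \<open>t\<close> and dividing by \<open>p\<^sup>2\<close> extends it to the lattice \<open>(1/p) t \<int>\<^sup>2\<close> containing \<open>\<int>\<^sup>2\<close>
  with index \<open>p\<close>; the form obtained is integral for exactly the \<open>t\<close> counted here.
\<close>

definition overlattice_count :: "int \<Rightarrow> bqf \<Rightarrow> nat" where
  "overlattice_count p F = card {t \<in> hermite_mats p. \<exists>f. bqf_act F t = bqf_scale (p\<^sup>2) f}"

text \<open>Double counting of the matrices of determinant \<open>p\<close> from classes of
  discriminant -D to classes of discriminant -p^2 D, each pair weighted by the reciprocal orders of
  both automorphism groups.\<close>

lemma hecke_correspondence:
  assumes p: "prime p" and D: "D > 0"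
  shows "(of_int p + 1) * hurwitz_class_number D
    = 2 * (\<Sum>K\<in>bqf_classes (p\<^sup>2 * D). of_nat (overlattice_count p (bqf_rep K)) / of_nat (card (bqf_auts (bqf_rep K))))"
proof -
  have p1: "p > 1" using p by (rule prime_gt_1_int)
  have D': "p\<^sup>2 * D > 0" using p1 D by simp
  define N where "N K L = card {M. mat_det M = p \<and> bqf_act (bqf_rep K) M = bqf_rep L}" for K L
  let ?w = "\<lambda>K. of_nat (card (bqf_auts (bqf_rep K))) :: rat"
  \<comment> \<open>From a fixed source all p + 1 Hermite matrices count, since each of them leads
    to a form of discriminant -p^2 D.\<close>
  have left: "(\<Sum>L\<in>bqf_classes (p\<^sup>2 * D). of_nat (N K L) / ?w L) = of_int p + 1"
    if K: "K \<in> bqf_classes D" for K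
  proof -
    have "{t \<in> hermite_mats p. \<exists>f \<in> pos_def_forms (p\<^sup>2 * D). bqf_act (bqf_rep K) t = bqf_scale 1 f}
        = hermite_mats p"
    proof (intro equalityI subsetI CollectI conjI)
      fix t assume t: "t \<in> hermite_mats p"
      show "\<exists>f \<in> pos_def_forms (p\<^sup>2 * D). bqf_act (bqf_rep K) t = bqf_scale 1 f"
        using bqf_act_pos_def_forms[OF D bqf_rep_mem(2)[OF K], of t] mat_det_hermite[OF t] p1
        by (intro bexI[of _ "bqf_act (bqf_rep K) t"]) simp_all
    qed simp_all
    then show ?thesis
      using sum_card_det_transporter[OF p D', of 1 "bqf_rep K"] p1
      by (simp add: N_def card_hermite_mats)
  qed
  have right: "(\<Sum>K\<in>bqf_classes D. of_nat (N K L) / ?w K) = of_nat (overlattice_count p (bqf_rep L))"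
    if L: "L \<in> bqf_classes (p\<^sup>2 * D)" for L
  proof -
    \<comment> \<open>Integrality of the quotient is the only condition: its definiteness is
      inherited, and its discriminant is forced by p^2 (p^2 D) = (p^2)^2 D.\<close>
    have "f \<in> pos_def_forms D"
      if "t \<in> hermite_mats p" "bqf_act (bqf_rep L) t = bqf_scale (p\<^sup>2) f" for t f
    proof -
      have "bqf_act (bqf_rep L) t \<in> pos_def_forms (p\<^sup>2 * (p\<^sup>2 * D))"
        using bqf_act_pos_def_forms[OF D' bqf_rep_mem(2)[OF L], of t] mat_det_hermite[OF that(1)] p1
        by simp
      moreover have "p\<^sup>2 * (p\<^sup>2 * D) = (p\<^sup>2)\<^sup>2 * D" by (simp add: power2_eq_square)
      ultimately show ?thesis
        using bqf_scale_pos_def_forms_iff[OF D, of "p\<^sup>2" f] that(2) p1 by simp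
    qed
    then have "{t \<in> hermite_mats p. \<exists>f \<in> pos_def_forms D. bqf_act (bqf_rep L) t = bqf_scale (p\<^sup>2) f}
        = {t \<in> hermite_mats p. \<exists>f. bqf_act (bqf_rep L) t = bqf_scale (p\<^sup>2) f}"
      by (intro Collect_cong conj_cong refl) (meson bexI)
    then have count: "overlattice_count p (bqf_rep L) =
        card {t \<in> hermite_mats p. \<exists>f \<in> pos_def_forms D. bqf_act (bqf_rep L) t = bqf_scale (p\<^sup>2) f}"
      unfolding overlattice_count_def by (rule arg_cong[OF sym])
    have p0: "p \<noteq> 0" "p\<^sup>2 \<noteq> 0" using p1 by simp_all
    show ?thesis
      unfolding count N_def card_det_transporter_adj[OF p0(1), of "bqf_rep K" "bqf_rep L" for K]
      by (rule sum_card_det_transporter[OF p D p0(2)])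
  qed
  have "(of_int p + 1) * (\<Sum>K\<in>bqf_classes D. 1 / ?w K)
      = (\<Sum>K\<in>bqf_classes D. (\<Sum>L\<in>bqf_classes (p\<^sup>2 * D). of_nat (N K L) / ?w L) / ?w K)"
    by (simp add: left sum_distrib_left)
  also have "\<dots> = (\<Sum>K\<in>bqf_classes D. \<Sum>L\<in>bqf_classes (p\<^sup>2 * D). of_nat (N K L) / ?w K / ?w L)"
    by (simp add: sum_divide_distrib mult.commute)
  also have "\<dots> = (\<Sum>L\<in>bqf_classes (p\<^sup>2 * D). (\<Sum>K\<in>bqf_classes D. of_nat (N K L) / ?w K) / ?w L)"
    by (subst sum.swap) (simp add: sum_divide_distrib)
  also have "\<dots> = (\<Sum>L\<in>bqf_classes (p\<^sup>2 * D). of_nat (overlattice_count p (bqf_rep L)) / ?w L)"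
    by (simp add: right)
  finally show ?thesis by (simp add: hurwitz_class_number_eq[OF D])
qed

section \<open>Hecke relations for Hurwitz class numbers\<close>

lemma ex_bqf_scale_iff: "(\<exists>f. (A, B, C) = bqf_scale k f) \<longleftrightarrow> k dvd A \<and> k dvd B \<and> k dvd C"
proof
  assume "k dvd A \<and> k dvd B \<and> k dvd C"
  then obtain a b c where "A = k * a" "B = k * b" "C = k * c" by (auto elim!: dvdE)
  then show "\<exists>f. (A, B, C) = bqf_scale k f" by (intro exI[of _ "(a, b, c)"]) simp
qed auto

text \<open>\<open>(p, 0, 0, 1)\<close> yields (p^2 A, p B, C) and \<open>(1, 0, j, p)\<close>
  yields (A + B j + C j^2, p (B + 2 C j), p^2 C); the conditions say that p^2 divides all
  coefficients.\<close>

lemma overlattice_count_eq: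
  fixes p :: int
  assumes p: "p > 1"
  shows "overlattice_count p (A, B, C) =
    (if p dvd B \<and> p\<^sup>2 dvd C then 1 else 0)
      + card {j \<in> {0..<p}. p\<^sup>2 dvd A + B * j + C * j\<^sup>2 \<and> p dvd B + 2 * C * j}"
proof -
  define P where "P t \<longleftrightarrow> (\<exists>f. bqf_act (A, B, C) t = bqf_scale (p\<^sup>2) f)" for t
  let ?J = "{j \<in> {0..<p}. p\<^sup>2 dvd A + B * j + C * j\<^sup>2 \<and> p dvd B + 2 * C * j}"
  have P1: "P (p, 0, 0, 1) \<longleftrightarrow> p dvd B \<and> p\<^sup>2 dvd C"
  proof -
    have "P (p, 0, 0, 1) \<longleftrightarrow> p\<^sup>2 dvd A * p\<^sup>2 \<and> p\<^sup>2 dvd B * p \<and> p\<^sup>2 dvd C"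
      unfolding P_def by (subst ex_bqf_scale_iff[symmetric]) simp
    then show ?thesis using p by (simp add: power2_eq_square)
  qed
  have P2: "P (1, 0, j, p) \<longleftrightarrow> p\<^sup>2 dvd A + B * j + C * j\<^sup>2 \<and> p dvd B + 2 * C * j" for j
  proof -
    have "P (1, 0, j, p) \<longleftrightarrow> p\<^sup>2 dvd A + B * j + C * j\<^sup>2 \<and> p\<^sup>2 dvd (B + 2 * C * j) * p \<and> p\<^sup>2 dvd C * p\<^sup>2"
      unfolding P_def by (subst ex_bqf_scale_iff[symmetric]) (simp add: algebra_simps)
    then show ?thesis using p by (simp add: power2_eq_square)
  qed
  have "{t \<in> hermite_mats p. P t} =
      (if p dvd B \<and> p\<^sup>2 dvd C then {(p, 0, 0, 1)} else {}) \<union> (\<lambda>j. (1, 0, j, p)) ` ?J"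
  proof (cases "p dvd B \<and> p\<^sup>2 dvd C")
    case True
    then have "P (p, 0, 0, 1)" using P1 by blast
    then show ?thesis using True by (auto simp: hermite_mats_def P2)
  next
    case False
    then have "\<not> P (p, 0, 0, 1)" using P1 by blast
    then show ?thesis using False by (auto simp: hermite_mats_def P2)
  qed
  then have "overlattice_count p (A, B, C) =
      card ((if p dvd B \<and> p\<^sup>2 dvd C then {(p, 0, 0, 1)} else {}) \<union> (\<lambda>j. (1, 0, j, p)) ` ?J :: mat2 set)"
    unfolding overlattice_count_def P_def by (rule arg_cong[where f = card])
  also have "\<dots> = card (if p dvd B \<and> p\<^sup>2 dvd C then {(p, 0, 0, 1) :: mat2} else {})
      + card ((\<lambda>j. (1 :: int, 0 :: int, j, p)) ` ?J)"
  proof (rule card_Un_disjoint)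
    have "finite ?J" by (rule finite_subset[of _ "{0..<p}"]) auto
    then show "finite ((\<lambda>j. (1 :: int, 0 :: int, j, p)) ` ?J)" by (rule finite_imageI)
  qed (use p in auto)
  also have "card ((\<lambda>j. (1 :: int, 0 :: int, j, p)) ` ?J) = card ?J"
    by (rule card_image) (auto simp: inj_on_def)
  finally show ?thesis by simp
qed

lemma linear_root_mod_prime:
  fixes p :: int
  assumes p: "prime p" and c: "\<not> p dvd c"
  shows "\<exists>r \<in> {0..<p}. \<forall>j \<in> {0..<p}. p dvd c * j + b \<longleftrightarrow> j = r"
proof -
  have p0: "p > 0" using p by (rule prime_gt_0_int)
  have "coprime c p" using p c by (metis coprime_commute prime_imp_coprime)
  then obtain u v where uv: "u * c + v * p = 1" using bezout_int[of c p] by auto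
  have "coprime u p"
    by (rule coprimeI) (metis uv dvd_add dvd_mult dvd_mult2)
  have "p dvd c * j + b \<longleftrightarrow> j = (- (u * b)) mod p" if j: "j \<in> {0..<p}" for j
  proof -
    have "p dvd c * j + b \<longleftrightarrow> p dvd u * (c * j + b)"
      using \<open>coprime u p\<close> by (simp add: coprime_dvd_mult_right_iff coprime_commute)
    also have "u * (c * j + b) = (j + u * b) + p * (- v * j)"
    proof -
      have "u * c = 1 - v * p" using uv by simp
      then have "u * c * j = (1 - v * p) * j" by simp
      then show ?thesis by (simp add: algebra_simps)
    qed
    also have "p dvd (j + u * b) + p * (- v * j) \<longleftrightarrow> p dvd j - (- (u * b))"
      by (subst dvd_add_left_iff) simp_all
    also have "\<dots> \<longleftrightarrow> j mod p = (- (u * b)) mod p" by (simp only: mod_eq_dvd_iff)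
    finally show ?thesis using j by simp
  qed
  then show ?thesis using p0 by (intro bexI[of _ "(- (u * b)) mod p"]) auto
qed

text \<open>Completing the square multiplies the value at (1, j) by 4 C, which is coprime to the odd
  prime \<open>p\<close>.\<close>

lemma dvd_quadratic_iff:
  fixes p :: int
  assumes p: "prime p" "p > 2" and C: "\<not> p dvd C"
  shows "p dvd A + B * j + C * j\<^sup>2 \<longleftrightarrow> p dvd (2 * C * j + B)\<^sup>2 - (B\<^sup>2 - 4 * A * C)"
    and "p\<^sup>2 dvd A + B * j + C * j\<^sup>2 \<longleftrightarrow> p\<^sup>2 dvd (2 * C * j + B)\<^sup>2 - (B\<^sup>2 - 4 * A * C)"
    and "\<not> p dvd 2 * C"
proof -
  have p2: "\<not> p dvd 2" using p(2) by (auto dest: zdvd_imp_le)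
  show "\<not> p dvd 2 * C" using p2 C p(1) by (simp add: prime_dvd_mult_iff)
  have "\<not> p dvd 4 * C"
    using p2 C p(1) prime_dvd_mult_iff[of p 2 "2 * C"] prime_dvd_mult_iff[of p 2 C] by simp
  then have cop: "coprime p (4 * C)" by (rule prime_imp_coprime[OF p(1)])
  then have cop2: "coprime (p\<^sup>2) (4 * C)" by (simp only: coprime_power_left_iff simp_thms)
  have e: "(2 * C * j + B)\<^sup>2 - (B\<^sup>2 - 4 * A * C) = 4 * C * (A + B * j + C * j\<^sup>2)"
    by (simp add: power2_eq_square algebra_simps)
  show "p dvd A + B * j + C * j\<^sup>2 \<longleftrightarrow> p dvd (2 * C * j + B)\<^sup>2 - (B\<^sup>2 - 4 * A * C)"
    unfolding e by (rule coprime_dvd_mult_right_iff[OF cop, symmetric])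
  show "p\<^sup>2 dvd A + B * j + C * j\<^sup>2 \<longleftrightarrow> p\<^sup>2 dvd (2 * C * j + B)\<^sup>2 - (B\<^sup>2 - 4 * A * C)"
    unfolding e by (rule coprime_dvd_mult_right_iff[OF cop2, symmetric])
qed

text \<open>Modulo \<open>p\<close> the form is a nonzero multiple of the square of a linear form,
  and only its single zero on the projective line can contribute. There divisibility by p^2 is
  automatic because p^2 divides the discriminant. If \<open>p dvd C\<close>, this zero lies at
  infinity, that is, at \<open>(p, 0, 0, 1)\<close>.\<close>

lemma overlattice_count_nondivisible:
  fixes p :: int
  assumes p: "prime p" "p > 2" and disc: "B\<^sup>2 - 4 * A * C = p\<^sup>2 * d"
    and nd: "\<not> (p dvd A \<and> p dvd B \<and> p dvd C)"
  shows "overlattice_count p (A, B, C) = 1"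
proof (cases "p dvd C")
  case False
  obtain r where r: "r \<in> {0..<p}" "\<And>j. j \<in> {0..<p} \<Longrightarrow> p dvd 2 * C * j + B \<longleftrightarrow> j = r"
    using linear_root_mod_prime[OF p(1) dvd_quadratic_iff(3)[OF p False], of B] by blast
  have "(p\<^sup>2 dvd A + B * j + C * j\<^sup>2 \<and> p dvd B + 2 * C * j) \<longleftrightarrow> p dvd 2 * C * j + B" for j
    unfolding dvd_quadratic_iff(2)[OF p False] disc by (auto simp: add.commute)
  then have "{j \<in> {0..<p}. p\<^sup>2 dvd A + B * j + C * j\<^sup>2 \<and> p dvd B + 2 * C * j} = {r}"
    using r by auto
  moreover have "\<not> p\<^sup>2 dvd C" using False by (auto simp: power2_eq_square dest: dvd_mult_left)
  ultimately show ?thesis using p by (simp add: overlattice_count_eq)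
next
  case True
  have "p dvd B\<^sup>2"
  proof -
    have "B\<^sup>2 = p * (p * d) + 4 * A * C" using disc by (simp add: power2_eq_square)
    then show ?thesis using True by simp
  qed
  then have B: "p dvd B" using p(1) prime_dvd_power by blast
  then have A: "\<not> p dvd A" using nd True by blast
  have "p\<^sup>2 dvd (4 * A) * C"
  proof -
    have "p\<^sup>2 dvd B\<^sup>2" using B by simp
    moreover have "4 * A * C = B\<^sup>2 - p\<^sup>2 * d" using disc by simp
    ultimately show ?thesis by simp
  qed
  moreover have "coprime (p\<^sup>2) (4 * A)"
  proof -
    have "\<not> p dvd 2" using p(2) by (auto dest: zdvd_imp_le)
    then have "\<not> p dvd 4 * A"
      using A p(1) prime_dvd_mult_iff[of p 2 "2 * A"] prime_dvd_mult_iff[of p 2 A] by simp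
    then have "coprime p (4 * A)" by (rule prime_imp_coprime[OF p(1)])
    then show ?thesis by (simp only: coprime_power_left_iff simp_thms)
  qed
  ultimately have "p\<^sup>2 dvd C" by (simp only: coprime_dvd_mult_right_iff)
  moreover have "card {j \<in> {0..<p}. p\<^sup>2 dvd A + B * j + C * j\<^sup>2 \<and> p dvd B + 2 * C * j} = 0"
  proof -
    have "\<not> p\<^sup>2 dvd A + (B * j + C * j\<^sup>2)" for j
    proof
      assume "p\<^sup>2 dvd A + (B * j + C * j\<^sup>2)"
      then have "p dvd A + (B * j + C * j\<^sup>2)"
        by (auto simp: power2_eq_square dest: dvd_mult_left)
      moreover have "p dvd B * j + C * j\<^sup>2" using B True by simp
      ultimately show False using A dvd_add_left_iff by blast
    qed
    then have "{j \<in> {0..<p}. p\<^sup>2 dvd A + B * j + C * j\<^sup>2 \<and> p dvd B + 2 * C * j} = {}"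
      by (simp add: add.assoc)
    then show ?thesis by (simp only: card.empty)
  qed
  ultimately show ?thesis using p B by (simp add: overlattice_count_eq)
qed

text \<open>One factor \<open>p\<close> cancels, and what remains counts the zeros of the form on
  the projective line over F_p, with \<open>p dvd C\<close> accounting for the point at
  infinity.\<close>

lemma overlattice_count_scale:
  fixes p :: int
  assumes p: "p > 1"
  shows "overlattice_count p (p * A, p * B, p * C) =
    (if p dvd C then 1 else 0) + card {j \<in> {0..<p}. p dvd A + B * j + C * j\<^sup>2}"
proof -
  have "(p\<^sup>2 dvd p * A + p * B * j + p * C * j\<^sup>2 \<and> p dvd p * B + 2 * (p * C) * j)
      \<longleftrightarrow> p dvd A + B * j + C * j\<^sup>2" for j
  proof -
    have "p * A + p * B * j + p * C * j\<^sup>2 = p * (A + B * j + C * j\<^sup>2)"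
      "p * B + 2 * (p * C) * j = p * (B + 2 * C * j)" by (simp_all add: algebra_simps)
    then show ?thesis using p by (simp add: power2_eq_square)
  qed
  moreover have "p\<^sup>2 dvd p * C \<longleftrightarrow> p dvd C" using p by (simp add: power2_eq_square)
  ultimately show ?thesis using p by (simp add: overlattice_count_eq)
qed

text \<open>A nondegenerate binary form over F_p has two zeros on the projective line or none,
  according to whether -D is a square.\<close>

lemma overlattice_count_scale_coprime:
  fixes p :: int
  assumes p: "prime p" "p > 2" and disc: "B\<^sup>2 - 4 * A * C = - D" and D: "\<not> p dvd D"
  shows "overlattice_count p (bqf_scale p (A, B, C)) = (if \<exists>x. p dvd x\<^sup>2 + D then 2 else 0)"
proof (cases "p dvd C")
  case False
  have iff: "p dvd A + B * j + C * j\<^sup>2 \<longleftrightarrow> p dvd (2 * C * j + B)\<^sup>2 + D" for j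
    unfolding dvd_quadratic_iff(1)[OF p False] disc by simp
  show ?thesis
  proof (cases "\<exists>x. p dvd x\<^sup>2 + D")
    case True
    then obtain x where x: "p dvd x\<^sup>2 + D" by blast
    note lin = linear_root_mod_prime[OF p(1) dvd_quadratic_iff(3)[OF p False]]
    obtain r where r: "r \<in> {0..<p}" "\<And>j. j \<in> {0..<p} \<Longrightarrow> p dvd 2 * C * j + (B - x) \<longleftrightarrow> j = r"
      using lin[of "B - x"] by blast
    obtain s where s: "s \<in> {0..<p}" "\<And>j. j \<in> {0..<p} \<Longrightarrow> p dvd 2 * C * j + (B + x) \<longleftrightarrow> j = s"
      using lin[of "B + x"] by blast
    \<comment> \<open>Equal roots would force \<open>p\<close> to divide 2x, hence \<open>x\<close>
      and then \<open>D\<close>.\<close>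
    have "r \<noteq> s"
    proof
      assume "r = s"
      then have "p dvd (2 * C * r + (B + x)) - (2 * C * r + (B - x))"
        using r s by (intro dvd_diff) blast+
      then have "p dvd 2 * x" by simp
      moreover have "\<not> p dvd 2" using p(2) by (auto dest: zdvd_imp_le)
      ultimately have "p dvd x" using p(1) by (simp add: prime_dvd_mult_iff)
      then have "p dvd x\<^sup>2" by (simp add: power2_eq_square)
      then show False using x D dvd_add_right_iff by blast
    qed
    have "p dvd A + B * j + C * j\<^sup>2 \<longleftrightarrow> j = r \<or> j = s" if "j \<in> {0..<p}" for j
    proof -
      have "(2 * C * j + B)\<^sup>2 + D = (2 * C * j + (B - x)) * (2 * C * j + (B + x)) + (x\<^sup>2 + D)"
        by (simp add: power2_eq_square algebra_simps)
      then have "p dvd (2 * C * j + B)\<^sup>2 + D \<longleftrightarrow> p dvd (2 * C * j + (B - x)) * (2 * C * j + (B + x))"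
        by (simp only: dvd_add_left_iff[OF x])
      then show ?thesis
        using p(1) r(2)[OF that] s(2)[OF that] by (simp add: iff prime_dvd_mult_iff)
    qed
    then have "{j \<in> {0..<p}. p dvd A + B * j + C * j\<^sup>2} = {r, s}" using r(1) s(1) by blast
    then show ?thesis using True False p \<open>r \<noteq> s\<close> by (simp add: overlattice_count_scale)
  next
    case nqr: False
    then have "{j \<in> {0..<p}. p dvd A + B * j + C * j\<^sup>2} = {}" using iff by blast
    then have "card {j \<in> {0..<p}. p dvd A + B * j + C * j\<^sup>2} = 0" by (simp only: card.empty)
    then show ?thesis using nqr False p by (simp add: overlattice_count_scale)
  qed
next
  case True
  \<comment> \<open>A zero at infinity exhibits -D as the square of \<open>B\<close> modulo
    \<open>p\<close>; the form is then linear in \<open>j\<close> and has one further, finite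
    zero.\<close>
  have "B\<^sup>2 + D = 4 * A * C" using disc by simp
  then have x: "p dvd B\<^sup>2 + D" using True by simp
  have B: "\<not> p dvd B"
  proof
    assume "p dvd B"
    then have "p dvd B\<^sup>2" by (simp add: power2_eq_square)
    then show False using x D dvd_add_right_iff by blast
  qed
  obtain r where r: "r \<in> {0..<p}" "\<And>j. j \<in> {0..<p} \<Longrightarrow> p dvd B * j + A \<longleftrightarrow> j = r"
    using linear_root_mod_prime[OF p(1) B, of A] by blast
  have "p dvd A + B * j + C * j\<^sup>2 \<longleftrightarrow> p dvd B * j + A" for j
    using True by (simp add: dvd_add_left_iff add.commute)
  then have "{j \<in> {0..<p}. p dvd A + B * j + C * j\<^sup>2} = {r}" using r by auto
  then show ?thesis using True x p by (auto simp: overlattice_count_scale)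
qed

text \<open>Now the form is degenerate but nonzero modulo \<open>p\<close>, so its only zero on the
  projective line is a double one.\<close>

lemma overlattice_count_scale_nondivisible:
  fixes p :: int
  assumes p: "prime p" "p > 2" and disc: "B\<^sup>2 - 4 * A * C = p\<^sup>2 * d"
    and nd: "\<not> (p dvd A \<and> p dvd B \<and> p dvd C)"
  shows "overlattice_count p (bqf_scale p (A, B, C)) = 1"
proof (cases "p dvd C")
  case False
  obtain r where r: "r \<in> {0..<p}" "\<And>j. j \<in> {0..<p} \<Longrightarrow> p dvd 2 * C * j + B \<longleftrightarrow> j = r"
    using linear_root_mod_prime[OF p(1) dvd_quadratic_iff(3)[OF p False], of B] by blast
  have "p dvd A + B * j + C * j\<^sup>2 \<longleftrightarrow> p dvd 2 * C * j + B" for j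
  proof -
    have "p dvd p\<^sup>2 * d" by (simp add: power2_eq_square)
    then have "p dvd (2 * C * j + B)\<^sup>2 - p\<^sup>2 * d \<longleftrightarrow> p dvd (2 * C * j + B)\<^sup>2"
      by (metis diff_add_cancel dvd_add_left_iff)
    then show ?thesis
      unfolding dvd_quadratic_iff(1)[OF p False] disc using p(1) by (simp add: prime_dvd_power_iff)
  qed
  then have "{j \<in> {0..<p}. p dvd A + B * j + C * j\<^sup>2} = {r}" using r by auto
  then show ?thesis using False p by (simp add: overlattice_count_scale)
next
  case True
  have "p dvd B\<^sup>2"
  proof -
    have "B\<^sup>2 = p * (p * d) + 4 * A * C" using disc by (simp add: power2_eq_square)
    then show ?thesis using True by simp
  qed
  then have B: "p dvd B" using p(1) prime_dvd_power by blast
  then have A: "\<not> p dvd A" using nd True by blast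
  have "\<not> p dvd A + (B * j + C * j\<^sup>2)" for j
    using A B True by (metis dvd_add dvd_add_left_iff dvd_mult2)
  then have "{j \<in> {0..<p}. p dvd A + B * j + C * j\<^sup>2} = {}" by (simp add: add.assoc)
  then have "card {j \<in> {0..<p}. p dvd A + B * j + C * j\<^sup>2} = 0" by (simp only: card.empty)
  then show ?thesis using True p by (simp add: overlattice_count_scale)
qed

text \<open>After one \<open>p\<close> is cancelled the form still vanishes identically modulo
  \<open>p\<close>, so all p + 1 points count.\<close>

lemma overlattice_count_scale_square:
  fixes p :: int
  assumes p: "p > 1"
  shows "overlattice_count p (bqf_scale (p\<^sup>2) f) = nat p + 1"
proof -
  obtain A B C where f: "f = (A, B, C)" by (cases f)
  have "{j \<in> {0..<p}. p dvd p * A + p * B * j + p * C * j\<^sup>2} = {0..<p}" by auto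
  then have "overlattice_count p (p * (p * A), p * (p * B), p * (p * C)) = 1 + nat p"
    by (simp only: overlattice_count_scale[OF p]) simp
  then show ?thesis by (simp add: f power2_eq_square mult.assoc)
qed

section \<open>Classes of divisible forms\<close>

lemma bqf_scale_class:
  assumes D: "D > 0" and k: "k > 0"
  shows "bqf_scale k ` {g \<in> pos_def_forms D. bqf_equiv f g}
    = {g \<in> pos_def_forms (k\<^sup>2 * D). bqf_equiv (bqf_scale k f) g}"
proof (intro equalityI subsetI)
  fix g assume "g \<in> bqf_scale k ` {g \<in> pos_def_forms D. bqf_equiv f g}"
  then obtain h where h: "g = bqf_scale k h" "h \<in> pos_def_forms D" "bqf_equiv f h" by blast
  obtain M where "M \<in> SL2" "h = bqf_act f M" using h(3) bqf_equiv_iff by blast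
  then have "bqf_equiv (bqf_scale k f) g"
    unfolding bqf_equiv_iff h(1) by (intro bexI[of _ M]) (simp_all add: bqf_act_scale)
  then show "g \<in> {g \<in> pos_def_forms (k\<^sup>2 * D). bqf_equiv (bqf_scale k f) g}"
    using h bqf_scale_pos_def_forms_iff[OF D k] by simp
next
  fix g assume g: "g \<in> {g \<in> pos_def_forms (k\<^sup>2 * D). bqf_equiv (bqf_scale k f) g}"
  then obtain M where M: "M \<in> SL2" "g = bqf_act (bqf_scale k f) M" using bqf_equiv_iff by blast
  then have g': "g = bqf_scale k (bqf_act f M)" by (simp add: bqf_act_scale)
  moreover have "bqf_act f M \<in> pos_def_forms D"
    using g bqf_scale_pos_def_forms_iff[OF D k] by (simp add: g')
  moreover have "bqf_equiv f (bqf_act f M)" using M(1) unfolding bqf_equiv_iff by (intro bexI[of _ M]) simp_all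
  ultimately show "g \<in> bqf_scale k ` {g \<in> pos_def_forms D. bqf_equiv f g}" by blast
qed

text \<open>Multiplication by \<open>k\<close> embeds the classes of discriminant -D into those of
  discriminant -k^2 D without changing automorphism groups; the image consists of the classes of
  forms divisible by \<open>k\<close>.\<close>

lemma sum_divisible_classes:
  assumes D: "D > 0" and k: "k > 0"
  shows "2 * (\<Sum>L | L \<in> bqf_classes (k\<^sup>2 * D) \<and> (\<exists>f. bqf_rep L = bqf_scale k f). 1 / of_nat (card (bqf_auts (bqf_rep L))))
    = hurwitz_class_number D"
proof -
  let ?S = "{L. L \<in> bqf_classes (k\<^sup>2 * D) \<and> (\<exists>f. bqf_rep L = bqf_scale k f)}"
  have img: "bqf_scale k ` K \<in> bqf_classes (k\<^sup>2 * D)" if K: "K \<in> bqf_classes D" for K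
  proof -
    note r = bqf_rep_mem[OF K]
    have "bqf_scale k (bqf_rep K) \<in> pos_def_forms (k\<^sup>2 * D)"
      using r(2) bqf_scale_pos_def_forms_iff[OF D k] by simp
    from bqf_class_mem[OF this] show ?thesis
      unfolding bqf_scale_class[OF D k, symmetric] bqf_class_eq[OF K r(1), symmetric] .
  qed
  \<comment> \<open>The representative chosen for the image class may differ from \<open>k\<close>
    times the one chosen for \<open>K\<close>; it is \<open>k\<close> times some member of
    \<open>K\<close>.\<close>
  have rep: "\<exists>f \<in> K. bqf_rep (bqf_scale k ` K) = bqf_scale k f" if K: "K \<in> bqf_classes D" for K
    using bqf_rep_mem(1)[OF img[OF K]] by blast
  have bij: "bij_betw ((`) (bqf_scale k)) (bqf_classes D) ?S"
  proof (rule bij_betw_imageI)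
    have "inj (bqf_scale k)" using k by (intro injI) (simp add: bqf_scale_inject)
    then show "inj_on ((`) (bqf_scale k)) (bqf_classes D)"
      by (intro inj_onI) (simp add: inj_image_eq_iff)
    show "(`) (bqf_scale k) ` bqf_classes D = ?S"
    proof (intro equalityI subsetI)
      fix L assume "L \<in> (`) (bqf_scale k) ` bqf_classes D"
      then obtain K where "K \<in> bqf_classes D" "L = bqf_scale k ` K" by blast
      then show "L \<in> ?S" using img rep by blast
    next
      fix L assume "L \<in> ?S"
      then obtain f where L: "L \<in> bqf_classes (k\<^sup>2 * D)" and f: "bqf_rep L = bqf_scale k f" by blast
      note r = bqf_rep_mem[OF L]
      have fD: "f \<in> pos_def_forms D" using r(2) f bqf_scale_pos_def_forms_iff[OF D k] by simp
      have "L = bqf_scale k ` {g \<in> pos_def_forms D. bqf_equiv f g}"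
        using bqf_class_eq[OF L r(1)] unfolding f bqf_scale_class[OF D k] .
      then show "L \<in> (`) (bqf_scale k) ` bqf_classes D" using bqf_class_mem[OF fD] by blast
    qed
  qed
  have card: "card (bqf_auts (bqf_rep (bqf_scale k ` K))) = card (bqf_auts (bqf_rep K))"
    if K: "K \<in> bqf_classes D" for K
  proof -
    obtain f where f: "f \<in> K" "bqf_rep (bqf_scale k ` K) = bqf_scale k f" using rep[OF K] by blast
    have "card (bqf_auts f) = card (bqf_auts (bqf_rep K))"
      using f(1) mem_bqf_class_iff[OF K] card_bqf_auts_equiv by blast
    then show ?thesis using k by (simp add: f(2) bqf_auts_scale)
  qed
  have "(\<Sum>L\<in>?S. 1 / (of_nat (card (bqf_auts (bqf_rep L))) :: rat))
      = (\<Sum>K\<in>bqf_classes D. 1 / of_nat (card (bqf_auts (bqf_rep (bqf_scale k ` K)))))"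
    by (rule sum.reindex_bij_betw[OF bij, symmetric])
  also have "\<dots> = (\<Sum>K\<in>bqf_classes D. 1 / of_nat (card (bqf_auts (bqf_rep K))))"
    by (intro sum.cong refl) (simp only: card)
  finally show ?thesis by (simp only: hurwitz_class_number_eq[OF D])
qed

section \<open>The Hecke relations\<close>

text \<open>Common core of both relations: the overlattice count is 1 plus a correction
  \<open>c\<close> on forms divisible by \<open>k\<close>, so the correspondence splits into H(p^2
  D) and \<open>c\<close> times the divisible part. The instances are k = p with c = 1 or -1, and k
  = p^2 with c = p.\<close>

lemma hecke_relation_aux:
  assumes p: "prime p" and D: "D > 0" and D': "D' > 0" and k: "k > 0" "p\<^sup>2 * D = k\<^sup>2 * D'"
    and count: "\<And>F. F \<in> pos_def_forms (p\<^sup>2 * D) \<Longrightarrow>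
      of_nat (overlattice_count p F) = 1 + (if \<exists>f. F = bqf_scale k f then c else (0 :: rat))"
  shows "(of_int p + 1) * hurwitz_class_number D
    = hurwitz_class_number (p\<^sup>2 * D) + c * hurwitz_class_number D'"
proof -
  have pD: "p\<^sup>2 * D > 0" using p D by (simp add: prime_gt_0_int)
  define w where "w L = 1 / (of_nat (card (bqf_auts (bqf_rep L))) :: rat)" for L
  define P where "P L \<longleftrightarrow> (\<exists>f. bqf_rep L = bqf_scale k f)" for L
  have "of_nat (overlattice_count p (bqf_rep L)) / of_nat (card (bqf_auts (bqf_rep L)))
      = w L + c * (if P L then w L else 0)" if L: "L \<in> bqf_classes (p\<^sup>2 * D)" for L
    using count[OF bqf_rep_mem(2)[OF L]] unfolding P_def[symmetric]
    by (simp add: w_def add_divide_distrib)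
  then have "(of_int p + 1) * hurwitz_class_number D
      = 2 * (\<Sum>L\<in>bqf_classes (p\<^sup>2 * D). w L + c * (if P L then w L else 0))"
    unfolding hecke_correspondence[OF p D] by (simp cong: sum.cong)
  also have "\<dots> = 2 * (\<Sum>L\<in>bqf_classes (p\<^sup>2 * D). w L)
      + c * (2 * (\<Sum>L | L \<in> bqf_classes (p\<^sup>2 * D) \<and> P L. w L))"
    using finite_bqf_classes[OF pD]
    by (simp add: sum.distrib sum_distrib_left[symmetric] sum.inter_filter[symmetric] algebra_simps)
  also have "2 * (\<Sum>L | L \<in> bqf_classes (p\<^sup>2 * D) \<and> P L. w L) = hurwitz_class_number D'"
    unfolding k(2) P_def w_def by (rule sum_divisible_classes[OF D' k(1)])
  also have "2 * (\<Sum>L\<in>bqf_classes (p\<^sup>2 * D). w L) = hurwitz_class_number (p\<^sup>2 * D)"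
    unfolding w_def by (rule hurwitz_class_number_eq[OF pD, symmetric])
  finally show ?thesis .
qed

theorem hurwitz_hecke_coprime:
  fixes p :: int
  assumes p: "prime p" "p > 2" and D: "D > 0" "\<not> p dvd D"
  shows "hurwitz_class_number (p\<^sup>2 * D)
    = of_int (if \<exists>x. p dvd x\<^sup>2 + D then p else p + 2) * hurwitz_class_number D"
proof -
  \<comment> \<open>\<open>c\<close> is the Legendre symbol of -D modulo \<open>p\<close>, nonzero
    because \<open>p\<close> does not divide \<open>D\<close>; it is the count 2 or 0 of zeros,
    minus 1.\<close>
  define c :: rat where "c = (if \<exists>x. p dvd x\<^sup>2 + D then 1 else - 1)"
  have "(of_int p + 1) * hurwitz_class_number D
      = hurwitz_class_number (p\<^sup>2 * D) + c * hurwitz_class_number D"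
  proof (rule hecke_relation_aux[OF p(1) D(1) D(1)])
    show "p > 0" using p by simp
    fix F assume F: "F \<in> pos_def_forms (p\<^sup>2 * D)"
    show "of_nat (overlattice_count p F) = 1 + (if \<exists>f. F = bqf_scale p f then c else 0)"
    proof (cases "\<exists>f. F = bqf_scale p f")
      case True
      then obtain f where f: "F = bqf_scale p f" by blast
      obtain A B C where f_eq: "f = (A, B, C)" by (cases f)
      have "f \<in> pos_def_forms D"
        using F f bqf_scale_pos_def_forms_iff[OF D(1)] p(2) by simp
      then have "B\<^sup>2 - 4 * A * C = - D" by (simp add: f_eq pos_def_forms_def)
      from overlattice_count_scale_coprime[OF p this D(2)] show ?thesis
        unfolding if_P[OF True] by (simp add: f f_eq c_def)
    next
      case False
      obtain A B C where F_eq: "F = (A, B, C)" by (cases F)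
      have "B\<^sup>2 - 4 * A * C = p\<^sup>2 * (- D)" using F by (simp add: F_eq pos_def_forms_def)
      moreover have "\<not> (p dvd A \<and> p dvd B \<and> p dvd C)"
        using False unfolding F_eq ex_bqf_scale_iff .
      ultimately have "overlattice_count p F = 1"
        unfolding F_eq by (rule overlattice_count_nondivisible[OF p])
      then show ?thesis unfolding if_not_P[OF False] by simp
    qed
  qed simp
  then have "hurwitz_class_number (p\<^sup>2 * D) = (of_int p + 1 - c) * hurwitz_class_number D"
    by (simp add: algebra_simps)
  also have "of_int p + 1 - c = of_int (if \<exists>x. p dvd x\<^sup>2 + D then p else p + 2)"
    by (simp add: c_def)
  finally show ?thesis .
qed

text \<open>With \<open>p^2 * D\<close> in place of \<open>D\<close> the Legendre symbol vanishes: a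
  form not divisible by p^2 has exactly one integral overlattice, whether or not \<open>p\<close>
  divides it. Forms divisible by p^2 have \<open>p\<close> more.\<close>

theorem hurwitz_hecke_square:
  fixes p :: int
  assumes p: "prime p" "p > 2" and D: "D > 0"
  shows "hurwitz_class_number (p\<^sup>2 * (p\<^sup>2 * D))
    = (of_int p + 1) * hurwitz_class_number (p\<^sup>2 * D) - of_int p * hurwitz_class_number D"
proof -
  have p0: "p > 0" using p by simp
  have D': "p\<^sup>2 * D > 0" using p D by simp
  have "(of_int p + 1) * hurwitz_class_number (p\<^sup>2 * D)
      = hurwitz_class_number (p\<^sup>2 * (p\<^sup>2 * D)) + of_int p * hurwitz_class_number D"
  proof (rule hecke_relation_aux[OF p(1) D' D])
    show "p\<^sup>2 > 0" using p by simp
    show "p\<^sup>2 * (p\<^sup>2 * D) = (p\<^sup>2)\<^sup>2 * D" by (simp add: power2_eq_square)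
    fix F assume F: "F \<in> pos_def_forms (p\<^sup>2 * (p\<^sup>2 * D))"
    show "of_nat (overlattice_count p F) = 1 + (if \<exists>f. F = bqf_scale (p\<^sup>2) f then of_int p else 0)"
    proof (cases "\<exists>f. F = bqf_scale (p\<^sup>2) f")
      case True
      then obtain f where "F = bqf_scale (p\<^sup>2) f" by blast
      then have "overlattice_count p F = nat p + 1" using overlattice_count_scale_square p(2) by simp
      then show ?thesis unfolding if_P[OF True] using p0 by simp
    next
      case no_square: False
      have "overlattice_count p F = 1"
      proof (cases "\<exists>f. F = bqf_scale p f")
        case True
        then obtain f where f: "F = bqf_scale p f" by blast
        obtain A B C where f_eq: "f = (A, B, C)" by (cases f)
        have "f \<in> pos_def_forms (p\<^sup>2 * D)"
          using F f bqf_scale_pos_def_forms_iff[OF D' p0] by simp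
        then have "B\<^sup>2 - 4 * A * C = p\<^sup>2 * (- D)" by (simp add: f_eq pos_def_forms_def)
        moreover have "\<not> (p dvd A \<and> p dvd B \<and> p dvd C)"
        proof
          assume "p dvd A \<and> p dvd B \<and> p dvd C"
          then obtain g where "(A, B, C) = bqf_scale p g" using ex_bqf_scale_iff by blast
          then have "F = bqf_scale (p\<^sup>2) g"
            by (cases g) (simp add: f f_eq power2_eq_square mult.assoc)
          then show False using no_square by blast
        qed
        ultimately show ?thesis
          unfolding f f_eq by (rule overlattice_count_scale_nondivisible[OF p])
      next
        case False
        obtain A B C where F_eq: "F = (A, B, C)" by (cases F)
        have "B\<^sup>2 - 4 * A * C = p\<^sup>2 * (- (p\<^sup>2 * D))" using F by (simp add: F_eq pos_def_forms_def)
        moreover have "\<not> (p dvd A \<and> p dvd B \<and> p dvd C)"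
          using False unfolding F_eq ex_bqf_scale_iff .
        ultimately show ?thesis
          unfolding F_eq by (rule overlattice_count_nondivisible[OF p])
      qed
      then show ?thesis unfolding if_not_P[OF no_square] by simp
    qed
  qed
  then show ?thesis by simp
qed

section \<open>Cancelling square factors modulo a prime\<close>

lemma cong_localized_zero_iff:
  "cong_localized l x 0 \<longleftrightarrow> (\<exists>p q. \<not> l dvd q \<and> x = of_int l * (of_int p / of_int q))"
  unfolding cong_localized_def localized_ints_def by (simp only: diff_zero) blast

lemma cong_localized_cancel_left:
  assumes l: "prime l" and k: "\<not> l dvd k" and x: "cong_localized l (of_int k * x) 0"
  shows "cong_localized l x 0"
proof -
  obtain p q where q: "\<not> l dvd q" and e: "of_int k * x = of_int l * (of_int p / of_int q)"
    using x by (auto simp: cong_localized_zero_iff)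
  have "k \<noteq> 0" "q \<noteq> 0" using k q by auto
  then have "x = of_int l * (of_int p / of_int (k * q))" using e by (simp add: field_simps)
  moreover have "\<not> l dvd k * q" using l k q by (simp add: prime_dvd_mult_iff)
  ultimately show ?thesis unfolding cong_localized_zero_iff by blast
qed

section \<open>Class numbers along powers of one prime\<close>

text \<open>The values satisfy h(n+2) = (p+1) h(n+1) - p h(n), a recurrence solved by p^n; hence two
  consecutive values are carried through the induction.\<close>

lemma hurwitz_split_power:
  fixes p :: int
  assumes p: "prime p" "p > 2" and m: "m > 0" "\<not> p dvd m" and qr: "p dvd x\<^sup>2 + m"
  shows "hurwitz_class_number (m * (p ^ n)\<^sup>2) = of_int (p ^ n) * hurwitz_class_number m
    \<and> hurwitz_class_number (m * (p ^ Suc n)\<^sup>2) = of_int (p ^ Suc n) * hurwitz_class_number m"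
proof (induction n)
  case 0
  have "\<exists>x. p dvd x\<^sup>2 + m" using qr by blast
  then show ?case using hurwitz_hecke_coprime[OF p m] by (simp add: mult.commute)
next
  case (Suc n)
  have "m * (p ^ n)\<^sup>2 > 0" using m p by simp
  from hurwitz_hecke_square[OF p this] Suc
  have "hurwitz_class_number (m * (p ^ Suc (Suc n))\<^sup>2)
      = (of_int p + 1) * (of_int (p ^ Suc n) * hurwitz_class_number m)
        - of_int p * (of_int (p ^ n) * hurwitz_class_number m)"
    by (simp add: power2_eq_square mult_ac)
  then show ?case using Suc by (simp add: algebra_simps)
qed

text \<open>The same recurrence, started with the factor p + 2. The exponents 1 and 3 are recorded
  because p and p^3 differ by a square, which can be compensated modulo \<open>a\<close>.\<close>

lemma hurwitz_inert_powers:
  fixes p :: int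
  assumes p: "prime p" "p > 2" and m: "m > 0" "\<not> p dvd m" and qr: "\<not> (\<exists>x. p dvd x\<^sup>2 + m)"
  shows "hurwitz_class_number (m * p\<^sup>2) = of_int (p + 2) * hurwitz_class_number m"
    and "hurwitz_class_number (m * (p ^ 3)\<^sup>2) = of_int (p ^ 3 + 2 * p\<^sup>2 + 2 * p + 2) * hurwitz_class_number m"
proof -
  let ?h = "hurwitz_class_number"
  have e1: "?h (p\<^sup>2 * m) = of_int (p + 2) * ?h m"
    using hurwitz_hecke_coprime[OF p m] qr by simp
  have e2: "?h (p\<^sup>2 * (p\<^sup>2 * m)) = (of_int p + 1) * ?h (p\<^sup>2 * m) - of_int p * ?h m"
    by (rule hurwitz_hecke_square[OF p m(1)])
  have "p\<^sup>2 * m > 0" using p m by simp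
  then have e3: "?h (p\<^sup>2 * (p\<^sup>2 * (p\<^sup>2 * m)))
      = (of_int p + 1) * ?h (p\<^sup>2 * (p\<^sup>2 * m)) - of_int p * ?h (p\<^sup>2 * m)"
    by (rule hurwitz_hecke_square[OF p])
  show "?h (m * p\<^sup>2) = of_int (p + 2) * ?h m" using e1 by (simp add: mult.commute)
  have "p\<^sup>2 * (p\<^sup>2 * (p\<^sup>2 * m)) = m * (p ^ 3)\<^sup>2"
    by (simp add: power2_eq_square power3_eq_cube)
  then show "?h (m * (p ^ 3)\<^sup>2) = of_int (p ^ 3 + 2 * p\<^sup>2 + 2 * p + 2) * ?h m"
    using e3 unfolding e2 e1 by (simp add: power2_eq_square power3_eq_cube algebra_simps)
qed

text \<open>Take for \<open>t\<close> the product of the primes dividing \<open>N\<close> but not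
  \<open>s\<close>. Each prime factor of \<open>N\<close> then divides exactly one of
  \<open>s\<close> and \<open>a * t\<close>; those dividing \<open>s\<close> avoid \<open>a\<close>
  by coprimality.\<close>

lemma exists_shift_coprime:
  fixes s a N :: int
  assumes "coprime s a" "N \<noteq> 0"
  shows "\<exists>t \<ge> 0. coprime (s + a * t) N"
proof -
  define T where "T = {q \<in> prime_factors N. \<not> q dvd s}"
  define t where "t = \<Prod>T"
  have T: "finite T" "\<And>q. q \<in> T \<Longrightarrow> prime q" by (auto simp: T_def in_prime_factors_iff)
  have "t \<ge> 0" unfolding t_def using T(2) by (intro prod_nonneg) (auto dest: prime_ge_0_int)
  moreover have "coprime (s + a * t) N"
  proof (rule ccontr)
    assume "\<not> coprime (s + a * t) N"
    then have "\<not> is_unit (gcd (s + a * t) N)" by (simp add: coprime_iff_gcd_eq_1)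
    moreover have "gcd (s + a * t) N \<noteq> 0" using assms(2) by simp
    ultimately obtain q where "prime q" "q dvd gcd (s + a * t) N"
      using prime_divisor_exists[of "gcd (s + a * t) N"] by blast
    then have q: "prime q" "q dvd s + a * t" "q dvd N" by simp_all
    show False
    proof (cases "q dvd s")
      case True
      then have "q dvd a * t" using q(2) dvd_add_right_iff by blast
      moreover have "\<not> q dvd a" using assms(1) True q(1) by (meson coprime_common_divisor not_prime_unit)
      ultimately have "q dvd t" using q(1) prime_dvd_mult_iff by blast
      then have "\<exists>r\<in>T. q dvd r"
        unfolding t_def by (simp only: prime_dvd_prod_iff[OF T(1) q(1)])
      then obtain r where r: "r \<in> T" "q dvd r" by blast
      then have "q = r" using primes_dvd_imp_eq[OF q(1) T(2)] by simp
      then show False using r True by (simp add: T_def)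
    next
      case False
      then have "q \<in> T" using q assms(2) by (simp add: T_def in_prime_factors_iff)
      then have "q dvd t" unfolding t_def using dvd_prodI[OF T(1), of q "\<lambda>x. x"] by simp
      then have "q dvd a * t" by simp
      then show False using q(2) False dvd_add_left_iff by blast
    qed
  qed
  ultimately show ?thesis by blast
qed

section \<open>Removing square factors, first by their primes and then by residue class\<close>

text \<open>Removing the full power p^n of a split prime from \<open>g\<close> divides the class
  number by p^n, a unit because \<open>p\<close> differs from \<open>l\<close>. The induction strips
  one prime at a time with \<open>m\<close> fixed.\<close>

lemma hurwitz_cancel_split:
  fixes l g :: int
  assumes l: "prime l"
  shows "g > 0 \<Longrightarrow> m > 0 \<Longrightarrow>
    (\<And>p. prime p \<Longrightarrow> p dvd g \<Longrightarrow> p > 2 \<and> \<not> p dvd m \<and> p \<noteq> l \<and> (\<exists>x. p dvd x\<^sup>2 + m)) \<Longrightarrow>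
    cong_localized l (hurwitz_class_number (m * g\<^sup>2)) 0 \<Longrightarrow>
    cong_localized l (hurwitz_class_number m) 0"
proof (induction "nat g" arbitrary: g rule: less_induct)
  case less
  show ?case
  proof (cases "g = 1")
    case True
    then show ?thesis using less.prems(4) by simp
  next
    case False
    then have "\<not> is_unit g" using less.prems(1) by (auto simp: zdvd1_eq)
    then obtain p where p: "prime p" "p dvd g"
      using less.prems(1) prime_divisor_exists[of g] by auto
    have p': "p > 2" "\<not> p dvd m" "p \<noteq> l" "\<exists>x. p dvd x\<^sup>2 + m" using less.prems(3)[OF p] by auto
    define n where "n = multiplicity p g"
    have "\<not> is_unit p" using p(1) not_prime_unit by blast
    then obtain k where k: "g = p ^ n * k" "\<not> p dvd k"
      using multiplicity_decompose'[of g p] less.prems(1) unfolding n_def by auto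
    have pn: "p ^ n > 1"
    proof -
      have "n \<noteq> 0" using k p(2) by (cases n) auto
      then show ?thesis using p'(1) by (simp add: one_less_power)
    qed
    have k0: "k > 0" using k(1) less.prems(1) pn zero_less_mult_pos[of "p ^ n" k] by simp
    have "k < g" using k(1) k0 pn by simp
    \<comment> \<open>Multiplying the root by \<open>k\<close> shows that \<open>p\<close> stays
      split for m k^2.\<close>
    have "p dvd (x * k)\<^sup>2 + m * k\<^sup>2" if "p dvd x\<^sup>2 + m" for x
    proof -
      have "(x * k)\<^sup>2 + m * k\<^sup>2 = (x\<^sup>2 + m) * k\<^sup>2" by (simp add: power2_eq_square algebra_simps)
      then show ?thesis using that by simp
    qed
    then obtain y where y: "p dvd y\<^sup>2 + m * k\<^sup>2" using p'(4) by blast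
    have mk: "m * k\<^sup>2 > 0" using less.prems(2) k0 by simp
    have pmk: "\<not> p dvd m * k\<^sup>2" using p(1) p'(2) k(2) by (simp add: prime_dvd_mult_iff prime_dvd_power_iff)
    have mg: "m * g\<^sup>2 = m * k\<^sup>2 * (p ^ n)\<^sup>2" by (simp add: k(1) power_mult_distrib mult_ac)
    have "cong_localized l (of_int (p ^ n) * hurwitz_class_number (m * k\<^sup>2)) 0"
      using less.prems(4) unfolding mg conjunct1[OF hurwitz_split_power[OF p(1) p'(1) mk pmk y]] .
    moreover have "\<not> l dvd p ^ n"
      using l p(1) p'(3) by (metis prime_dvd_power primes_dvd_imp_eq)
    ultimately have "cong_localized l (hurwitz_class_number (m * k\<^sup>2)) 0"
      using cong_localized_cancel_left[OF l] by blast
    moreover have "prime q \<Longrightarrow> q dvd k \<Longrightarrow> q > 2 \<and> \<not> q dvd m \<and> q \<noteq> l \<and> (\<exists>x. q dvd x\<^sup>2 + m)" for q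
      using less.prems(3)[of q] by (simp add: k(1))
    ultimately show ?thesis
      using less.hyps[of k] \<open>k < g\<close> k0 less.prems(2) by simp
  qed
qed

text \<open>If \<open>x\<close> is coprime to N m, every prime dividing x^2 + m N^2 is split, since
  -m is (x/N)^2 modulo it. Choosing \<open>x\<close> congruent to \<open>s\<close> modulo
  \<open>a\<close> gives this number the residue s^2.\<close>

lemma hurwitz_cancel_square_class:
  fixes l a s m :: int
  assumes l: "prime l" and a: "a \<ge> 1" and s: "coprime s a" and m: "m > 0"
    and hyp: "\<And>g. g > 0 \<Longrightarrow> a dvd g - s\<^sup>2 \<Longrightarrow> cong_localized l (hurwitz_class_number (m * g\<^sup>2)) 0"
  shows "cong_localized l (hurwitz_class_number m) 0"
proof -
  \<comment> \<open>The factors of \<open>N\<close> keep the primes of \<open>g\<close> away from 2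
    and \<open>l\<close> and make \<open>g\<close> congruent to s^2 modulo \<open>a\<close>.\<close>
  define N where "N = 2 * a * l"
  have l0: "l > 0" using l by (rule prime_gt_0_int)
  have "N * m \<noteq> 0" using a m l0 by (simp add: N_def)
  then obtain t where t: "coprime (s + a * t) (N * m)" using exists_shift_coprime[OF s] by blast
  define x where "x = s + a * t"
  define g where "g = x\<^sup>2 + m * N\<^sup>2"
  have "N\<^sup>2 > 0" using a l0 by (simp add: N_def)
  then have g0: "g > 0" using m by (simp add: g_def add_nonneg_pos)
  have "g - s\<^sup>2 = a * (2 * s * t + a * t\<^sup>2 + m * (2 * l) * N)"
    by (simp add: g_def x_def N_def power2_eq_square algebra_simps)
  then have "a dvd g - s\<^sup>2" by simp
  from hyp[OF g0 this] have "cong_localized l (hurwitz_class_number (m * g\<^sup>2)) 0" .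
  moreover have "p > 2 \<and> \<not> p dvd m \<and> p \<noteq> l \<and> (\<exists>y. p dvd y\<^sup>2 + m)" if p: "prime p" "p dvd g" for p
  proof -
    have pN: "\<not> p dvd N * m"
    proof
      assume h: "p dvd N * m"
      then have "p dvd m * N\<^sup>2" by (metis dvd_mult2 mult.commute mult.assoc power2_eq_square)
      then have "p dvd x\<^sup>2" using p(2) unfolding g_def using dvd_add_left_iff by blast
      then have "p dvd x" using p(1) prime_dvd_power by blast
      then show False using h t p(1) unfolding x_def by (meson coprime_common_divisor not_prime_unit)
    qed
    then have "\<not> p dvd N" "\<not> p dvd m" "\<not> p dvd 2" "\<not> p dvd l" by (auto simp: N_def)
    moreover have "p > 2" using \<open>\<not> p dvd 2\<close> prime_ge_2_int[OF p(1)] by (cases "p = 2") auto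
    moreover have "\<exists>y. p dvd y\<^sup>2 + m"
    proof -
      have "coprime N p" using p(1) \<open>\<not> p dvd N\<close> by (metis coprime_commute prime_imp_coprime)
      \<comment> \<open>\<open>u\<close> inverts \<open>N\<close> modulo \<open>p\<close>, so
        \<open>u * x\<close> is the required root.\<close>
      then obtain u v where uv: "u * N + v * p = 1" using bezout_int[of N p] by auto
      have "(u * x)\<^sup>2 + m = u\<^sup>2 * g + p * (m * v * (2 - v * p))"
      proof -
        have "u * N = 1 - v * p" using uv by simp
        have "u\<^sup>2 * g = (u * x)\<^sup>2 + m * (u * N)\<^sup>2" by (simp add: g_def power2_eq_square algebra_simps)
        also have "\<dots> = (u * x)\<^sup>2 + m * (1 - v * p)\<^sup>2" by (simp only: \<open>u * N = 1 - v * p\<close>)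
        finally show ?thesis by (simp add: power2_eq_square algebra_simps)
      qed
      then show ?thesis using p(2) by (intro exI[of _ "u * x"]) simp
    qed
    ultimately show ?thesis by auto
  qed
  ultimately show ?thesis using hurwitz_cancel_split[OF l g0 m] by blast
qed

text \<open>The hypothesis ranges over the whole residue class of \<open>g\<close>, so factors that
  are squares of units modulo \<open>a\<close> can be inserted or removed. In the induction
  \<open>g\<close> shrinks, while \<open>m\<close> may absorb the prime powers stripped off.\<close>

lemma hurwitz_cancel_class:
  fixes l a g :: int
  assumes l: "prime l" "l > 3" and a: "a \<ge> 1"
  shows "g > 0 \<Longrightarrow> m > 0 \<Longrightarrow> coprime g (2 * l * m * a) \<Longrightarrow>
    (\<And>g'. g' > 0 \<Longrightarrow> a dvd g' - g \<Longrightarrow> cong_localized l (hurwitz_class_number (m * g'\<^sup>2)) 0) \<Longrightarrow>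
    cong_localized l (hurwitz_class_number m) 0"
proof (induction "nat g" arbitrary: g m rule: less_induct)
  case less
  note g0 = less.prems(1) and m0 = less.prems(2) and cop = less.prems(3) and hyp = less.prems(4)
  show ?case
  proof (cases "g = 1")
    case True
    then show ?thesis using hyp[of 1] by simp
  next
    case False
    then have "\<not> is_unit g" using g0 by (auto simp: zdvd1_eq)
    then obtain p where p: "prime p" "p dvd g" using g0 prime_divisor_exists[of g] by auto
    then obtain k where k: "g = p * k" by blast
    have p1: "p > 1" using p(1) by (rule prime_gt_1_int)
    have k0: "k > 0" using k g0 p1 by (simp add: zero_less_mult_iff)
    have kg: "k < g" using k k0 p1 by simp
    have pcop: "coprime p (2 * l * m * a)" and kcop: "coprime k (2 * l * m * a)"
      using cop by (simp_all add: k coprime_mult_left_iff)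
    have pa: "coprime p a" using pcop by simp
    have "\<not> p dvd 2 * l * m * a"
      using pcop p(1) by (meson coprime_common_divisor dvd_refl not_prime_unit)
    then have pn: "\<not> p dvd 2" "\<not> p dvd l" "\<not> p dvd m" by auto
    have p2: "p > 2" using pn(1) p1 by (cases "p = 2") auto
    show ?thesis
    proof (cases "p dvd k")
      case True
      then obtain k' where k': "k = p * k'" by blast
      have k'0: "k' > 0" using k' k0 p1 by (simp add: zero_less_mult_iff)
      have "k' < g" using k' k'0 p1 kg by (smt (verit) mult_less_cancel_right1)
      have kcop': "coprime k' (2 * l * m * a)" using kcop by (simp add: k' coprime_mult_left_iff)
      \<comment> \<open>For \<open>h\<close> congruent to \<open>k'\<close>, the factor missing to
        reach the class of \<open>g\<close> is p^2, a square of a unit, so it is removed without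
        examining the contribution of \<open>p\<close>.\<close>
      have "cong_localized l (hurwitz_class_number (m * h\<^sup>2)) 0" if h: "h > 0" "a dvd h - k'" for h
      proof (rule hurwitz_cancel_square_class[OF l(1) a pa])
        show "m * h\<^sup>2 > 0" using m0 h by simp
        fix g' assume g': "g' > 0" "a dvd g' - p\<^sup>2"
        have "h * g' - g = (h - k') * g' + k' * (g' - p\<^sup>2)"
          by (simp add: k k' power2_eq_square algebra_simps)
        then have "a dvd h * g' - g" using h g' by simp
        moreover have "h * g' > 0" using h g' by simp
        ultimately have "cong_localized l (hurwitz_class_number (m * (h * g')\<^sup>2)) 0" using hyp by blast
        then show "cong_localized l (hurwitz_class_number (m * h\<^sup>2 * g'\<^sup>2)) 0"
          by (simp add: power_mult_distrib mult.assoc)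
      qed
      then show ?thesis using less.hyps[of k' m] \<open>k' < g\<close> k'0 m0 kcop' by simp
    next
      case pk: False
      \<comment> \<open>The induction hypothesis will be applied to \<open>m\<close> times a power
        of \<open>p\<close>, to which \<open>k\<close> has to be coprime.\<close>
      have kp: "coprime k p" using p(1) pk by (metis coprime_commute prime_imp_coprime)
      have lp: "\<not> l dvd p" using l(1) p(1) pn(2) by (metis primes_dvd_imp_eq dvd_refl)
      \<comment> \<open>If \<open>p\<close> contributes a unit \<open>c\<close>, then
        \<open>p\<close> moves from \<open>g\<close> into \<open>m\<close>, and \<open>c\<close> is
        cancelled afterwards.\<close>
      have first: ?thesis if c: "\<not> l dvd c"
          "hurwitz_class_number (m * p\<^sup>2) = of_int c * hurwitz_class_number m" for c
      proof -
        have "cong_localized l (hurwitz_class_number (m * p\<^sup>2)) 0"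
        proof (rule less.hyps[of k])
          show "nat k < nat g" "k > 0" "m * p\<^sup>2 > 0" using kg k0 m0 p1 by simp_all
          show "coprime k (2 * l * (m * p\<^sup>2) * a)" using kcop kp by simp
          fix h assume h: "h > 0" "a dvd h - k"
          have "p * h - g = p * (h - k)" by (simp add: k algebra_simps)
          then have "a dvd p * h - g" using h by simp
          moreover have "p * h > 0" using p1 h by simp
          ultimately have "cong_localized l (hurwitz_class_number (m * (p * h)\<^sup>2)) 0" using hyp by blast
          then show "cong_localized l (hurwitz_class_number (m * p\<^sup>2 * h\<^sup>2)) 0"
            by (simp add: power_mult_distrib mult.assoc)
        qed
        then show ?thesis using cong_localized_cancel_left[OF l(1) c(1)] c(2) by simp
      qed
      \<comment> \<open>Here p^3 moves into \<open>m\<close> instead. The excess p^2 is undone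
        modulo \<open>a\<close> by factors in the class of u^2, where \<open>u\<close> inverts
        \<open>p\<close>.\<close>
      have third: ?thesis if c: "\<not> l dvd c"
          "hurwitz_class_number (m * (p ^ 3)\<^sup>2) = of_int c * hurwitz_class_number m" for c
      proof -
        obtain u v where uv: "u * p + v * a = 1" using pa bezout_int[of p a] by auto
        have ua: "coprime u a"
          by (rule coprimeI) (metis uv dvd_add dvd_mult dvd_mult2)
        have "cong_localized l (hurwitz_class_number (m * (p ^ 3)\<^sup>2)) 0"
        proof (rule less.hyps[of k])
          show "nat k < nat g" "k > 0" "m * (p ^ 3)\<^sup>2 > 0" using kg k0 m0 p1 by simp_all
          show "coprime k (2 * l * (m * (p ^ 3)\<^sup>2) * a)" using kcop kp by simp
          fix h assume h: "h > 0" "a dvd h - k"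
          show "cong_localized l (hurwitz_class_number (m * (p ^ 3)\<^sup>2 * h\<^sup>2)) 0"
          proof (rule hurwitz_cancel_square_class[OF l(1) a ua])
            show "m * (p ^ 3)\<^sup>2 * h\<^sup>2 > 0" using m0 h p1 by simp
            fix g' assume g': "g' > 0" "a dvd g' - u\<^sup>2"
            have up: "u * p = 1 - v * a" using uv by simp
            have "p ^ 3 * h * g' - g
                = p ^ 3 * h * (g' - u\<^sup>2) + p * ((u * p)\<^sup>2 * (h - k)) + p * k * ((u * p)\<^sup>2 - 1)"
              by (simp add: k power2_eq_square power3_eq_cube algebra_simps)
            moreover have "a dvd (u * p)\<^sup>2 - 1"
            proof -
              have "(u * p)\<^sup>2 - 1 = a * (v * (v * a - 2))"
                unfolding up by (simp add: power2_eq_square algebra_simps)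
              then show ?thesis by simp
            qed
            ultimately have "a dvd p ^ 3 * h * g' - g" using h g' by simp
            moreover have "p ^ 3 * h * g' > 0" using p1 h g' by simp
            ultimately have "cong_localized l (hurwitz_class_number (m * (p ^ 3 * h * g')\<^sup>2)) 0"
              using hyp by blast
            then show "cong_localized l (hurwitz_class_number (m * (p ^ 3)\<^sup>2 * h\<^sup>2 * g'\<^sup>2)) 0"
              by (simp only: power_mult_distrib mult.assoc)
          qed
        qed
        then show ?thesis using cong_localized_cancel_left[OF l(1) c(1)] c(2) by simp
      qed
      show ?thesis
      proof (cases "\<exists>x. p dvd x\<^sup>2 + m")
        case True
        then have "hurwitz_class_number (m * p\<^sup>2) = of_int p * hurwitz_class_number m"
          using hurwitz_hecke_coprime[OF p(1) p2 m0 pn(3)] by (simp add: mult.commute)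
        then show ?thesis using first[OF lp] by blast
      next
        case inert: False
        note eqs = hurwitz_inert_powers[OF p(1) p2 m0 pn(3) inert]
        show ?thesis
        proof (cases "l dvd p + 2")
          case False
          then show ?thesis using first eqs(1) by blast
        next
          case True
          \<comment> \<open>Modulo p + 2 the contribution of p^3 is -2, a unit at \<open>l\<close>
            because l > 3.\<close>
          have "(p + 2) * (p\<^sup>2 + 2) - (p ^ 3 + 2 * p\<^sup>2 + 2 * p + 2) = 2"
            by (simp add: power2_eq_square power3_eq_cube algebra_simps)
          moreover have "\<not> l dvd 2" using l(2) by (auto dest: zdvd_imp_le)
          ultimately have "\<not> l dvd p ^ 3 + 2 * p\<^sup>2 + 2 * p + 2"
            using True by (metis dvd_diff dvd_mult2)
          then show ?thesis using third eqs(2) by blast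
        qed
      qed
    qed
  qed
qed

section \<open>Passing from the residue class of b to that of b u^2\<close>

theorem theoremB:
  fixes l a b :: int
  assumes "prime l" and "l > 3" and "a \<ge> 1"
    and "\<And>n :: int. cong_localized l (hurwitz_class_number (a * n + b)) 0"
  shows "\<forall>u n :: int. gcd u a = 1 \<longrightarrow>
           cong_localized l (hurwitz_class_number (a * n + b * u\<^sup>2)) 0"
proof (intro allI impI)
  fix u n :: int
  assume gcd: "gcd u a = 1"
  define m where "m = a * n + b * u\<^sup>2"
  obtain v w where vw: "v * u + w * a = 1" using gcd bezout_int[of u a] by auto
  have va: "coprime v a"
    by (rule coprimeI) (metis vw dvd_add dvd_mult dvd_mult2)
  \<comment> \<open>\<open>v\<close> inverts \<open>u\<close> modulo \<open>a\<close>, so m g^2 is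
    congruent to \<open>b\<close> for every \<open>g\<close> in the class of \<open>v\<close>, and
    the assumption applies.\<close>
  have mg: "cong_localized l (hurwitz_class_number (m * g\<^sup>2)) 0" if g: "a dvd g - v" for g
  proof -
    obtain k where k: "g = v + a * k" using g by (metis dvdE add.commute diff_eq_eq)
    have vu: "v * u = 1 - w * a" using vw by simp
    have "g * u = v * u + a * k * u" by (simp add: k algebra_simps)
    then have gu: "g * u = 1 + a * (k * u - w)" unfolding vu by (simp add: algebra_simps)
    have "m * g\<^sup>2 = a * (n * g\<^sup>2) + b * (g * u)\<^sup>2"
      by (simp add: m_def power2_eq_square algebra_simps)
    also have "\<dots> = a * (n * g\<^sup>2) + b * (1 + a * (k * u - w))\<^sup>2" by (simp only: gu)
    also have "\<dots> = a * (n * g\<^sup>2 + b * (k * u - w) * (2 + a * (k * u - w))) + b"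
      by (simp add: power2_eq_square algebra_simps)
    finally show ?thesis using assms(4) by simp
  qed
  have "cong_localized l (hurwitz_class_number m) 0"
  proof (cases "m > 0")
    case True
    have l0: "l > 0" using assms(2) by simp
    have "2 * l * m * a \<noteq> 0" using True l0 assms(3) by simp
    then obtain t where t: "coprime (v + a * t) (2 * l * m * a)"
      using exists_shift_coprime[OF va] by blast
    define N where "N = 2 * l * m * a"
    \<comment> \<open>The added multiple of \<open>N\<close> makes \<open>g\<close> positive and
      keeps both its class modulo \<open>a\<close> and its coprimality to \<open>N\<close>.\<close>
    define g where "g = v + a * t + N * (\<bar>v + a * t\<bar> + 1)"
    have N: "N \<ge> 1" using True l0 assms(3) by (simp add: N_def int_one_le_iff_zero_less)
    have "\<bar>v + a * t\<bar> + 1 \<le> N * (\<bar>v + a * t\<bar> + 1)"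
      using mult_right_mono[OF N, of "\<bar>v + a * t\<bar> + 1"] by simp
    then have g0: "g > 0" unfolding g_def by linarith
    have cop: "coprime g N"
      using t gcd_add_mult[of N "\<bar>v + a * t\<bar> + 1" "v + a * t"]
      unfolding g_def N_def[symmetric]
      by (simp only: coprime_iff_gcd_eq_1 gcd.commute[of _ N] mult.commute[of N] add.commute)
    have "g - v = a * (t + 2 * l * m * (\<bar>v + a * t\<bar> + 1))"
      by (simp add: g_def N_def algebra_simps)
    then have "a dvd g - v" by simp
    then have "cong_localized l (hurwitz_class_number (m * g'\<^sup>2)) 0" if "a dvd g' - g" for g'
      using mg[of g'] dvd_add[OF that, of "g - v"] by simp
    then show ?thesis
      using hurwitz_cancel_class[OF assms(1,2,3) g0 True] cop unfolding N_def by blast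
  next
    case False
    show ?thesis
    proof (cases "m = 0")
      case True
      \<comment> \<open>For m = 0 the number m v^2 is again 0, so H(0) is itself one of the values
        covered by the assumption.\<close>
      then show ?thesis using mg[of v] by simp
    next
      case neg: False
      then have "hurwitz_class_number m = 0" using False by (simp add: hurwitz_class_number_def)
      moreover have "\<not> l dvd 1" using assms(2) by simp
      ultimately show ?thesis
        unfolding cong_localized_zero_iff by (intro exI[of _ 0] exI[of _ 1]) simp
    qed
  qed
  then show "cong_localized l (hurwitz_class_number (a * n + b * u\<^sup>2)) 0" by (simp only: m_def)
qed

end
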